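(* As $x \to \infty$, \[ \frac{2\pi x}{\log^2 x} \ll S_{1,2}(x) = \sum_{n \le x} r_1(n)\, r_2(n) \ll \frac{x}{\log^2 x}(\log\log x)^2 . \]
   Context: $\mathbb{P}$ denotes the set of primes and $\mathbb{N}$ the natural numbers. For $n \in \mathbb{N}$ define $r_1(n) = \#\{(a,p) \in \mathbb{N}\times\mathbb{P} : n = a^2+p^2\}$ and $r_2(n) = \#\{(p,q) \in \mathbb{P}^2 : n = p^2+q^2\}$. *)

theory Defs
  imports Complex_Main "HOL-Library.Landau_Symbols" "HOL-Computational_Algebra.Primes"
begin

text \<open>Representation functions: ordered pairs are counted. The natural numbers are taken to
  start at 1; admitting \<open>a = 0\<close> in \<open>r1\<close> would only change \<open>r1 n\<close> at squares of primes \<open>n\<close>, where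
  \<open>r2 n = 0\<close>, so \<open>S12\<close> does not depend on this convention.\<close>

definition r1 :: "nat \<Rightarrow> nat" where
  "r1 n = card {(a, p). 0 < (a::nat) \<and> prime p \<and> n = a\<^sup>2 + p\<^sup>2}"

definition r2 :: "nat \<Rightarrow> nat" where
  "r2 n = card {(p, q). prime p \<and> prime q \<and> n = p\<^sup>2 + q\<^sup>2}"

definition S12 :: "real \<Rightarrow> real" where
  "S12 x = (\<Sum>n | 0 < n \<and> real n \<le> x. real (r1 n) * real (r2 n))"

end

theory Submission
  imports Defs "HOL-Number_Theory.Cong" "HOL-Real_Asymp.Real_Asymp"
begin

text \<open>
  The lower bound only uses \<open>r1 n \<ge> 1\<close> whenever \<open>r2 n \<ge> 1\<close>, so that \<open>S12 x\<close> is at least the number of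
  pairs of primes \<open>p, q \<le> (x/2)^(1/2)\<close>, together with Chebyshev's lower bound.

  For the upper bound, \<open>S12 x\<close> counts the solutions of \<open>a\<^sup>2 + p\<^sup>2 = q\<^sup>2 + r\<^sup>2 \<le> x\<close> with \<open>p, q, r\<close> prime.
  Solutions with \<open>p \<in> {q, r}\<close> or with one of the primes equal to 2 are negligible by Chebyshev's
  upper bound. All others are parametrised by \<open>q = u v - w z\<close>, \<open>r = u w + v z\<close>, \<open>p = u w - v z\<close>, where
  \<open>max u |z| * max v w \<le> X = x^(1/2)\<close>; exchanging the two pairs if necessary, one may assume that the second
  maximum \<open>m\<close> is at most \<open>X^(1/2)\<close>. For fixed \<open>v, w, z\<close> these are three linear forms in \<open>u \<le> X/m\<close>,
  and Selberg's sieve shows that they are simultaneously prime for \<open>O((X/m) (ln ln X)\<^sup>2 / (ln X)\<^sup>3)\<close>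
  values of \<open>u\<close>. Summing over \<open>z\<close> and over \<open>v, w \<le> X^(1/2)\<close> brings in a factor \<open>X \<Sum>1/m = O(X ln X)\<close>.

  The two factors \<open>ln ln X\<close> arise because for primes up to \<open>ln X\<close>, and for primes at which two of the
  forms share a root or one of them degenerates, only one residue class is removed instead of three.
\<close>

section \<open>Sums over square-free products\<close>

text \<open>The sieve in u saves (ln X)^3 only if the logarithm of the length of its range is
  comparable to ln X. This is why the pair with the smaller maximum m \<le> X^(1/2) supplies the
  coefficients: u then has a range of length about X/m \<ge> X^(1/2). Three sieved primes save three
  logarithms, the harmonic sum over m gives one back, and two remain. The number a carries no
  condition of its own, being determined by p, q and r.

  The sieve densities are bounded from below without prime number asymptotics. The one-dimensional
  density is at least a harmonic sum, hence a logarithm, and the three-dimensional one dominates a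
  product of three one-dimensional ones. Deleting the bad primes from two of these three factors
  costs the square of their local product. Mertens' upper bound for the primes up to ln X makes this
  (ln ln X)^2; the larger bad primes are O(ln X) in number and contribute a factor 1 + O(1/ln X)
  each, hence O(1) altogether. The cut at ln X is chosen for this balance.\<close>

text \<open>Square-free integers composed of primes in \<open>P\<close> are represented by subsets of \<open>P\<close>.\<close>

definition subset_sum :: "nat set \<Rightarrow> (nat \<Rightarrow> real) \<Rightarrow> real \<Rightarrow> real" where
  "subset_sum P a Y = (\<Sum>S | S \<subseteq> P \<and> real (\<Prod>S) \<le> Y. \<Prod>p\<in>S. a p)"

text \<open>A subset containing p is \<open>insert p S\<close> with the product of S at most Y/p.
  This recursion drives the inductions over P below.\<close>

lemma subset_sum_insert:
  assumes "finite P" "p \<notin> P" "p > 0"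
  shows "subset_sum (insert p P) a Y = subset_sum P a Y + a p * subset_sum P a (Y / real p)"
proof -
  let ?A = "{S. S \<subseteq> P \<and> real (\<Prod>S) \<le> Y}"
  let ?B = "{S. S \<subseteq> P \<and> real (\<Prod>S) \<le> Y / real p}"
  have fin: "finite ?A" "finite ?B"
    using assms(1) by (auto intro: finite_subset[of _ "Pow P"])
  have prod_ins: "\<Prod>(insert p S) = p * \<Prod>S" if "S \<subseteq> P" for S
    using that assms finite_subset[OF that] by (subst prod.insert) auto
  have eq: "{S. S \<subseteq> insert p P \<and> real (\<Prod>S) \<le> Y} = ?A \<union> insert p ` ?B"
  proof (intro equalityI subsetI)
    fix S assume S: "S \<in> {S. S \<subseteq> insert p P \<and> real (\<Prod>S) \<le> Y}"
    show "S \<in> ?A \<union> insert p ` ?B"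
    proof (cases "p \<in> S")
      case True
      then have "S = insert p (S - {p})" "S - {p} \<subseteq> P" using S by auto
      moreover have "S - {p} \<in> ?B"
      proof -
        have "real (\<Prod>S) = real p * real (\<Prod>(S - {p}))"
          using prod_ins[OF calculation(2)] calculation(1) by (metis of_nat_mult)
        then show ?thesis
          using S calculation(2) assms(3) by (simp add: field_simps del: of_nat_prod)
      qed
      ultimately show ?thesis by blast
    next
      case False
      then show ?thesis using S by auto
    qed
  next
    fix S assume "S \<in> ?A \<union> insert p ` ?B"
    then show "S \<in> {S. S \<subseteq> insert p P \<and> real (\<Prod>S) \<le> Y}"
      using prod_ins assms(3) by (auto simp: field_simps of_nat_prod[symmetric] simp del: of_nat_prod)
  qed
  have disj: "?A \<inter> insert p ` ?B = {}" using assms(2) by auto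
  have inj: "inj_on (insert p) ?B" 
    using assms(2) by (auto simp: inj_on_def)
  have "(\<Sum>S\<in>insert p ` ?B. \<Prod>q\<in>S. a q) = (\<Sum>S\<in>?B. a p * (\<Prod>q\<in>S. a q))"
    unfolding sum.reindex[OF inj] o_def
  proof (rule sum.cong[OF refl])
    fix S assume "S \<in> ?B"
    then have "finite S" "p \<notin> S" using assms finite_subset by auto
    then show "(\<Prod>q\<in>insert p S. a q) = a p * (\<Prod>q\<in>S. a q)" by simp
  qed
  then show ?thesis
    unfolding subset_sum_def eq using disj fin
    by (subst sum.union_disjoint) (auto simp: sum_distrib_left)
qed

lemma subset_sum_mono:
  assumes "finite P" "\<And>p. p \<in> P \<Longrightarrow> 0 \<le> a p" "Y \<le> Z"
  shows "subset_sum P a Y \<le> subset_sum P a Z"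
  unfolding subset_sum_def using assms
  by (intro sum_mono2) (auto intro!: finite_subset[of _ "Pow P"] prod_nonneg)

lemma subset_sum_mono_weight:
  assumes "\<And>p. p \<in> P \<Longrightarrow> 0 \<le> a p" "\<And>p. p \<in> P \<Longrightarrow> a p \<le> b p"
  shows "subset_sum P a Y \<le> subset_sum P b Y"
  unfolding subset_sum_def using assms
  by (intro sum_mono prod_mono) blast

lemma subset_sum_nonneg:
  assumes "\<And>p. p \<in> P \<Longrightarrow> 0 \<le> a p"
  shows "0 \<le> subset_sum P a Y"
  unfolding subset_sum_def using assms by (auto intro!: sum_nonneg prod_nonneg)

lemma subset_sum_empty: "subset_sum {} a Y = (if 1 \<le> Y then 1 else 0)"
proof -
  have "{S. S \<subseteq> {} \<and> real (\<Prod>S) \<le> Y} = (if 1 \<le> Y then {{}} else {})" by auto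
  then show ?thesis unfolding subset_sum_def by simp
qed

lemma subset_sum_ge_1:
  assumes "finite P" "\<And>p. p \<in> P \<Longrightarrow> 0 \<le> a p" "1 \<le> Y"
  shows "1 \<le> subset_sum P a Y"
proof -
  have "(\<Sum>S\<in>{{}}. \<Prod>p\<in>S. a p) \<le> subset_sum P a Y"
    unfolding subset_sum_def using assms
    by (intro sum_mono2) (auto intro!: finite_subset[of _ "Pow P"] prod_nonneg)
  then show ?thesis by simp
qed

text \<open>For square-free d \<le> Y and e \<le> Z the lcm is at most Y Z. The weight
  \<open>a p + b p + a p * b p\<close> collects the three ways in which p can divide the lcm, so
  that the local factors satisfy 1 + c = (1 + a)(1 + b).\<close>

lemma subset_sum_mult_le:
  assumes "finite P" "\<And>p. p \<in> P \<Longrightarrow> 0 < p" "\<And>p. p \<in> P \<Longrightarrow> 0 \<le> a p" "\<And>p. p \<in> P \<Longrightarrow> 0 \<le> b p"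
    and "0 \<le> Y" "0 \<le> Z"
  shows "subset_sum P a Y * subset_sum P b Z \<le> subset_sum P (\<lambda>p. a p + b p + a p * b p) (Y * Z)"
  using assms
proof (induction P arbitrary: Y Z rule: finite_induct)
  case empty
  have "1 \<le> Y * Z" if "1 \<le> Y" "1 \<le> Z" using mult_mono[OF that] that by simp
  then show ?case by (simp add: subset_sum_empty)
next
  case (insert p P)
  define c where "c = (\<lambda>p. a p + b p + a p * b p)"
  have p: "0 < p" "0 \<le> a p" "0 \<le> b p" "1 \<le> real p" using insert.prems by (auto simp: Suc_le_eq)
  have nn: "\<And>q. q \<in> P \<Longrightarrow> 0 \<le> c q" using insert.prems by (auto simp: c_def)
  have IH: "subset_sum P a Y * subset_sum P b Z \<le> subset_sum P c (Y * Z)" 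
    if "0 \<le> Y" "0 \<le> Z" for Y Z
    using insert.IH[of Y Z] insert.prems that unfolding c_def by auto
  have 1: "subset_sum P a Y * subset_sum P b Z \<le> subset_sum P c (Y * Z)"
    using IH insert.prems by auto
  have 2: "subset_sum P a (Y / p) * subset_sum P b Z \<le> subset_sum P c (Y * Z / p)"
    using IH[of "Y / p" Z] insert.prems by auto
  have 3: "subset_sum P a Y * subset_sum P b (Z / p) \<le> subset_sum P c (Y * Z / p)"
    using IH[of Y "Z / p"] insert.prems by auto
  have "subset_sum P a (Y / p) * subset_sum P b (Z / p) \<le> subset_sum P c (Y / p * (Z / p))"
    using IH[of "Y / p" "Z / p"] insert.prems by auto
  \<comment> \<open>If p divides both d and e, the lcm contains it once although both truncations
    were divided by p; monotonicity in the level gives up the second division.\<close>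
  also have "\<dots> \<le> subset_sum P c (Y * Z / p)"
  proof (rule subset_sum_mono[OF insert.hyps(1) nn])
    have "Y * Z / p / p \<le> Y * Z / p / 1"
      using p insert.prems by (intro divide_left_mono) auto
    then show "Y / p * (Z / p) \<le> Y * Z / p" by simp
  qed
  finally have 4: "subset_sum P a (Y / p) * subset_sum P b (Z / p) \<le> subset_sum P c (Y * Z / p)" .
  have "subset_sum (insert p P) a Y * subset_sum (insert p P) b Z =
      subset_sum P a Y * subset_sum P b Z + a p * (subset_sum P a (Y / p) * subset_sum P b Z)
      + b p * (subset_sum P a Y * subset_sum P b (Z / p))
      + (a p * b p) * (subset_sum P a (Y / p) * subset_sum P b (Z / p))"
    using insert.hyps p by (simp add: subset_sum_insert algebra_simps)
  also have "\<dots> \<le> subset_sum P c (Y * Z) + a p * subset_sum P c (Y * Z / p)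
      + b p * subset_sum P c (Y * Z / p) + (a p * b p) * subset_sum P c (Y * Z / p)"
    using 1 2 3 4 p by (intro add_mono mult_left_mono) auto
  also have "\<dots> = subset_sum (insert p P) c (Y * Z)"
    using insert.hyps p by (simp add: subset_sum_insert algebra_simps c_def)
  finally show ?case unfolding c_def .
qed

text \<open>A prime of B is removed at the cost of its full local factor 1 + a p, because the part
  divisible by p has the lower level Y/p \<le> Y.\<close>

lemma subset_sum_drop_primes:
  assumes "finite P" "\<And>p. p \<in> P \<Longrightarrow> 0 < p" "\<And>p. p \<in> P \<Longrightarrow> 0 \<le> a p" "0 \<le> Y"
  shows "subset_sum P a Y \<le> (\<Prod>p\<in>P \<inter> B. 1 + a p) * subset_sum P (\<lambda>p. if p \<in> B then 0 else a p) Y"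
  using assms
proof (induction P arbitrary: Y rule: finite_induct)
  case empty
  then show ?case by (simp add: subset_sum_empty)
next
  case (insert p P)
  let ?b = "\<lambda>p. if p \<in> B then 0 else a p"
  have p: "0 < p" "0 \<le> a p" "1 \<le> real p" using insert.prems by (auto simp: Suc_le_eq)
  have IH: "subset_sum P a Y \<le> (\<Prod>p\<in>P \<inter> B. 1 + a p) * subset_sum P ?b Y" if "0 \<le> Y" for Y
    using insert that by auto
  have nn: "0 \<le> (\<Prod>p\<in>P \<inter> B. 1 + a p)" using insert.prems by (intro prod_nonneg) auto
  show ?case
  proof (cases "p \<in> B")
    case True
    have Yp: "Y / p \<le> Y" using divide_left_mono[of 1 "real p" Y] p insert.prems by simp
    have "subset_sum (insert p P) a Y = subset_sum P a Y + a p * subset_sum P a (Y / p)"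
      using insert.hyps p by (simp add: subset_sum_insert)
    also have "\<dots> \<le> subset_sum P a Y + a p * subset_sum P a Y"
      using insert.hyps insert.prems p Yp by (intro add_left_mono mult_left_mono subset_sum_mono) auto
    also have "\<dots> = (1 + a p) * subset_sum P a Y" by (simp add: algebra_simps)
    also have "\<dots> \<le> (1 + a p) * ((\<Prod>p\<in>P \<inter> B. 1 + a p) * subset_sum P ?b Y)"
      using IH[of Y] insert.prems p by (intro mult_left_mono) auto
    finally show ?thesis using True insert.hyps p
      by (simp add: subset_sum_insert mult.assoc)
  next
    case False
    have "subset_sum (insert p P) a Y = subset_sum P a Y + a p * subset_sum P a (Y / p)"
      using insert.hyps p by (simp add: subset_sum_insert)
    also have "\<dots> \<le> (\<Prod>p\<in>P \<inter> B. 1 + a p) * subset_sum P ?b Y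
        + a p * ((\<Prod>p\<in>P \<inter> B. 1 + a p) * subset_sum P ?b (Y / p))"
      using IH[of Y] IH[of "Y / p"] p insert.prems by (intro add_mono mult_left_mono) auto
    finally show ?thesis using False insert.hyps p
      by (simp add: subset_sum_insert algebra_simps)
  qed
qed

section \<open>Sifting residue classes\<close>

lemma card_residues_prod:
  fixes \<Omega> :: "nat \<Rightarrow> nat set"
  assumes "finite S" "\<And>p. p \<in> S \<Longrightarrow> prime p" "\<And>p. p \<in> S \<Longrightarrow> \<Omega> p \<subseteq> {..<p}"
  shows "card {c \<in> {..<\<Prod>S}. \<forall>p\<in>S. c mod p \<in> \<Omega> p} = (\<Prod>p\<in>S. card (\<Omega> p))"
  using assms
proof (induction S rule: finite_induct)
  case empty
  have "{c::nat. c = 0} = {0}" by auto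
  then show ?case by simp
next
  case (insert p S)
  let ?d = "\<Prod>S"
  let ?A = "{c \<in> {..<\<Prod>(insert p S)}. \<forall>q\<in>insert p S. c mod q \<in> \<Omega> q}"
  let ?B = "{c \<in> {..<?d}. \<forall>q\<in>S. c mod q \<in> \<Omega> q}"
  have prodeq: "\<Prod>(insert p S) = p * ?d" using insert by simp
  have p: "prime p" "\<Omega> p \<subseteq> {..<p}" using insert.prems by auto
  have dpos: "?d > 0" using insert.prems by (auto intro!: prod_pos simp: prime_gt_0_nat)
  have cop: "coprime p ?d"
    using insert.hyps insert.prems by (intro prod_coprime_right primes_coprime) auto
  have dv: "q dvd ?d" if "q \<in> S" for q using that insert.hyps dvd_prodI[of S q "\<lambda>x. x"] by simp
  have "bij_betw (\<lambda>c. (c mod p, c mod ?d)) ?A (\<Omega> p \<times> ?B)"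
    unfolding bij_betw_def
  proof (intro conjI inj_onI equalityI subsetI)
    fix x y assume x: "x \<in> ?A" and y: "y \<in> ?A" and e: "(x mod p, x mod ?d) = (y mod p, y mod ?d)"
    then have "[x = y] (mod p)" "[x = y] (mod ?d)" unfolding Cong.cong_def by blast+
    then have "[x = y] (mod p * ?d)" by (rule coprime_cong_mult_nat[OF _ _ cop])
    then show "x = y" using x y prodeq by (simp add: Cong.cong_def)
  next
    fix z assume "z \<in> (\<lambda>c. (c mod p, c mod ?d)) ` ?A"
    then show "z \<in> \<Omega> p \<times> ?B"
      using dpos dv by (auto simp: mod_mod_cancel)
  next
    fix z assume "z \<in> \<Omega> p \<times> ?B"
    then obtain a b where z: "z = (a, b)" "a \<in> \<Omega> p" "b \<in> ?B" by auto
    have "p \<noteq> 0" "?d \<noteq> 0" using p dpos by auto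
    from binary_chinese_remainder_unique_nat[OF cop this, of a b]
    obtain x where x: "x < p * ?d" "[x = a] (mod p)" "[x = b] (mod ?d)" by blast
    have xa: "x mod p = a" using x(2) z(2) p by (auto simp: Cong.cong_def)
    have xb: "x mod ?d = b" using x(3) z(3) by (auto simp: Cong.cong_def)
    have "x mod q \<in> \<Omega> q" if "q \<in> S" for q
    proof -
      have "x mod q = b mod q" using xb dv[OF that] by (metis mod_mod_cancel)
      then show ?thesis using z(3) that by auto
    qed
    then have "x \<in> ?A" using x(1) xa z(2) prodeq by auto
    then show "z \<in> (\<lambda>c. (c mod p, c mod ?d)) ` ?A" using xa xb z(1) by blast
  qed
  then have "card ?A = card (\<Omega> p \<times> ?B)" by (rule bij_betw_same_card)
  then show ?case using insert by (simp add: card_cartesian_product)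
qed

lemma card_periodic_multiple:
  fixes Q :: "nat \<Rightarrow> bool"
  assumes "\<And>t. Q (t mod d) = Q t"
  shows "card {t \<in> {..<k * d}. Q t} = k * card {t \<in> {..<d}. Q t}"
proof (induction k)
  case (Suc k)
  have eq: "{t \<in> {..<Suc k * d}. Q t} = {t \<in> {..<k * d}. Q t} \<union> (\<lambda>t. k * d + t) ` {t \<in> {..<d}. Q t}"
  proof (intro equalityI subsetI)
    fix t assume t: "t \<in> {t \<in> {..<Suc k * d}. Q t}"
    show "t \<in> {t \<in> {..<k * d}. Q t} \<union> (\<lambda>t. k * d + t) ` {t \<in> {..<d}. Q t}"
    proof (cases "t < k * d")
      case False
      then obtain s where s: "t = k * d + s" by (metis le_Suc_ex not_less)
      then have "s < d" using t by auto
      moreover have "Q s" using t assms[of t] assms[of s] by (simp add: s)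
      ultimately show ?thesis using s by auto
    qed (use t in auto)
  next
    fix t assume "t \<in> {t \<in> {..<k * d}. Q t} \<union> (\<lambda>t. k * d + t) ` {t \<in> {..<d}. Q t}"
    then consider "t < k * d" "Q t" | s where "t = k * d + s" "s < d" "Q s" by auto
    then show "t \<in> {t \<in> {..<Suc k * d}. Q t}"
    proof cases
      case 2
      then have "Q t" using assms[of t] assms[of s] by simp
      then show ?thesis using 2 by auto
    qed auto
  qed
  have "card {t \<in> {..<Suc k * d}. Q t} = card {t \<in> {..<k * d}. Q t} + card ((\<lambda>t. k * d + t) ` {t \<in> {..<d}. Q t})"
    unfolding eq by (rule card_Un_disjoint) auto
  also have "card ((\<lambda>t. k * d + t) ` {t \<in> {..<d}. Q t}) = card {t \<in> {..<d}. Q t}"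
    by (rule card_image) auto
  finally show ?case using Suc by simp
qed simp

lemma card_periodic_approx:
  fixes Q :: "nat \<Rightarrow> bool"
  assumes per: "\<And>t. Q (t mod d) = Q t" and d: "d > 0"
  shows "\<bar>real (card {t \<in> {..<N}. Q t}) - real N * (real (card {t \<in> {..<d}. Q t}) / real d)\<bar> \<le> real d"
proof -
  let ?c = "card {t \<in> {..<d}. Q t}"
  let ?k = "N div d"
  have cd: "?c \<le> d" using card_mono[of "{..<d}" "{t \<in> {..<d}. Q t}"] by auto
  have N: "?k * d \<le> N" "N \<le> Suc ?k * d"
    using d dividend_less_div_times[of d N] by (auto simp: less_imp_le)
  have "?k * ?c \<le> card {t \<in> {..<N}. Q t}"
    unfolding card_periodic_multiple[where Q = Q, OF per, symmetric]
    using N by (intro card_mono Collect_mono) (auto intro: less_le_trans)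
  moreover have "card {t \<in> {..<N}. Q t} \<le> Suc ?k * ?c"
    unfolding card_periodic_multiple[where Q = Q, OF per, symmetric]
    using N by (intro card_mono Collect_mono) (auto intro: less_le_trans)
  ultimately have A: "real ?k * real ?c \<le> real (card {t \<in> {..<N}. Q t})"
     "real (card {t \<in> {..<N}. Q t}) \<le> real ?k * real ?c + real ?c"
    by (auto simp flip: of_nat_mult of_nat_add)
  have "real ?k * d \<le> N" "N \<le> (real ?k + 1) * d"
    using N[folded of_nat_le_iff[where ?'a = real]] by (auto simp: algebra_simps)
  then have "real ?k * d * (?c / d) \<le> N * (?c / d)" "N * (?c / d) \<le> (real ?k + 1) * d * (?c / d)"
    by (auto intro!: mult_right_mono simp del: times_divide_eq_right)
  then have "real ?k * ?c \<le> N * (?c / d)" "N * (?c / d) \<le> real ?k * ?c + ?c"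
    using d by (simp_all add: field_simps)
  then show ?thesis using A cd by linarith
qed

text \<open>Over one period \<Prod>S the count is exact by the Chinese remainder theorem, and an
  incomplete period changes it by at most the period. An error as large as the modulus is affordable
  because the sieve level will be a small power of N.\<close>

lemma card_residue_classes_approx:
  fixes \<Omega> :: "nat \<Rightarrow> nat set"
  assumes "finite S" "\<And>p. p \<in> S \<Longrightarrow> prime p" "\<And>p. p \<in> S \<Longrightarrow> \<Omega> p \<subseteq> {..<p}"
  shows "\<bar>real (card {t \<in> {..<N}. \<forall>p\<in>S. t mod p \<in> \<Omega> p}) - real N * (\<Prod>p\<in>S. real (card (\<Omega> p)) / real p)\<bar>
           \<le> real (\<Prod>S)"
proof -
  have dpos: "\<Prod>S > 0" using assms by (auto intro!: prod_pos simp: prime_gt_0_nat)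
  have "(\<forall>p\<in>S. t mod \<Prod>S mod p \<in> \<Omega> p) = (\<forall>p\<in>S. t mod p \<in> \<Omega> p)" for t
    using assms(1) dvd_prodI[of S _ "\<lambda>x. x"] by (intro ball_cong refl) (simp add: mod_mod_cancel)
  from card_periodic_approx[where Q = "\<lambda>t. \<forall>p\<in>S. t mod p \<in> \<Omega> p", OF this dpos, of N]
  show ?thesis
    using card_residues_prod[OF assms] by (simp add: prod_dividef)
qed

text \<open>Mobius inversion on the lattice of subsets: the sum is \<plusminus> the product of 1 - 1
  over the elements of T - K.\<close>

lemma sum_Pow_between:
  fixes K T :: "'a set"
  assumes "finite T"
  shows "(\<Sum>S | K \<subseteq> S \<and> S \<subseteq> T. (-1::real) ^ card S) = (if K = T then (-1) ^ card K else 0)"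
proof (cases "K \<subseteq> T")
  case True
  have finK: "finite K" using True assms finite_subset by blast
  have eq: "{S. K \<subseteq> S \<and> S \<subseteq> T} = (\<lambda>R. K \<union> R) ` Pow (T - K)"
  proof (intro equalityI subsetI)
    fix S assume "S \<in> {S. K \<subseteq> S \<and> S \<subseteq> T}"
    then have "S = K \<union> (S - K)" "S - K \<in> Pow (T - K)" by auto
    then show "S \<in> (\<lambda>R. K \<union> R) ` Pow (T - K)" by blast
  qed (use True in auto)
  have inj: "inj_on (\<lambda>R. K \<union> R) (Pow (T - K))" by (auto simp: inj_on_def)
  have "(\<Sum>S | K \<subseteq> S \<and> S \<subseteq> T. (-1::real) ^ card S) = (\<Sum>R\<in>Pow (T - K). (-1) ^ card (K \<union> R))"
    unfolding eq sum.reindex[OF inj] by simp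
  also have "\<dots> = (\<Sum>R\<in>Pow (T - K). (-1) ^ card K * (-1) ^ card R)"
  proof (rule sum.cong[OF refl])
    fix R assume "R \<in> Pow (T - K)"
    then have "card (K \<union> R) = card K + card R"
      using assms finK finite_subset by (intro card_Un_disjoint) auto
    then show "(-1::real) ^ card (K \<union> R) = (-1) ^ card K * (-1) ^ card R" by (simp add: power_add)
  qed
  also have "\<dots> = (-1) ^ card K * (\<Sum>R\<in>Pow (T - K). \<Prod>i\<in>R. -1)"
    by (simp add: sum_distrib_left)
  also have "(\<Sum>R\<in>Pow (T - K). \<Prod>i\<in>R. -1::real) = (\<Prod>i\<in>T - K. 0)"
    using prod_add[of "T - K" "\<lambda>_. -1::real" "\<lambda>_. 1"] assms by simp
  also have "\<dots> = (if K = T then 1 else 0)"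
    using assms True by (auto simp: power_0_left)
  finally show ?thesis by auto
next
  case False
  then have "{S. K \<subseteq> S \<and> S \<subseteq> T} = {}" "K \<noteq> T" by auto
  then show ?thesis by (simp only: sum.empty if_False)
qed

section \<open>Selberg's sieve\<close>

lemma inj_on_Prod_primes:
  assumes "finite P" "\<And>p. p \<in> P \<Longrightarrow> prime (p::nat)"
  shows "inj_on (\<lambda>S. \<Prod>S) (Pow P)"
proof (rule inj_onI)
  have key: "S = {p. prime p \<and> p dvd \<Prod>S}" if "S \<in> Pow P" for S
  proof -
    have fin: "finite S" using that assms finite_subset by auto
    have "p dvd \<Prod>S \<longleftrightarrow> p \<in> S" if p: "prime p" for p
    proof
      assume "p dvd \<Prod>S"
      then obtain q where "q \<in> S" "p dvd q" using prime_dvd_prod_iff[OF fin p, of "\<lambda>x. x"] by auto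
      then show "p \<in> S" using p assms that \<open>S \<in> Pow P\<close> primes_dvd_imp_eq by blast
    qed (use dvd_prodI[OF fin, of p "\<lambda>x. x"] in simp)
    then show ?thesis using that assms by auto
  qed
  fix S T assume "S \<in> Pow P" "T \<in> Pow P" "\<Prod>S = \<Prod>T"
  then show "S = T" using key by metis
qed

lemma card_subsets_Prod_le:
  assumes "finite P" "\<And>p. p \<in> P \<Longrightarrow> prime (p::nat)" "0 \<le> D"
  shows "real (card {S. S \<subseteq> P \<and> real (\<Prod>S) \<le> D}) \<le> D"
proof -
  have "card {S. S \<subseteq> P \<and> real (\<Prod>S) \<le> D} \<le> card {1..nat \<lfloor>D\<rfloor>}"
  proof (rule card_inj_on_le)
    show "inj_on (\<lambda>S. \<Prod>S) {S. S \<subseteq> P \<and> real (\<Prod>S) \<le> D}"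
      by (rule inj_on_subset[OF inj_on_Prod_primes[OF assms(1,2)]]) auto
    show "(\<lambda>S. \<Prod>S) ` {S. S \<subseteq> P \<and> real (\<Prod>S) \<le> D} \<subseteq> {1..nat \<lfloor>D\<rfloor>}"
    proof (intro image_subsetI)
      fix S assume S: "S \<in> {S. S \<subseteq> P \<and> real (\<Prod>S) \<le> D}"
      have "\<Prod>S > 0" using S assms(2) by (intro prod_pos) (auto simp: prime_gt_0_nat)
      moreover have "\<Prod>S \<le> nat \<lfloor>D\<rfloor>" using S by (simp add: le_nat_floor del: of_nat_prod)
      ultimately show "\<Prod>S \<in> {1..nat \<lfloor>D\<rfloor>}" by simp
    qed
  qed auto
  then have "real (card {S. S \<subseteq> P \<and> real (\<Prod>S) \<le> D}) \<le> real (nat \<lfloor>D\<rfloor>)"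
    by (simp del: of_nat_prod)
  also have "\<dots> \<le> D" using assms(3) by simp
  finally show ?thesis .
qed

text \<open>If \<open>lam {} = 1\<close>, the square of the sum of \<open>lam S\<close> over those S
  all of whose classes contain t majorises the indicator of the surviving t. Expanding the square
  leads to counts over S \<union> T, whose main term is a quadratic form in \<open>lam\<close>; the
  chosen weights give it the value 1/J, where J is the denominator in the bound. The remainder
  \<open>D ^ 6\<close> consists of at most D^2 pairs (S, T), each with \<open>lam S * lam T\<close>
  of size at most D^2 and a counting error of at most D^2.\<close>

lemma selberg_sieve:
  fixes \<Omega> :: "nat \<Rightarrow> nat set" and N :: nat and D :: real
  assumes P: "finite P" "\<And>p. p \<in> P \<Longrightarrow> prime p"
    and \<Omega>: "\<And>p. p \<in> P \<Longrightarrow> \<Omega> p \<subseteq> {..<p}" "\<And>p. p \<in> P \<Longrightarrow> 0 < card (\<Omega> p)"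
      "\<And>p. p \<in> P \<Longrightarrow> card (\<Omega> p) < p"
    and D: "1 \<le> D"
  shows "real (card {t \<in> {..<N}. \<forall>p\<in>P. t mod p \<notin> \<Omega> p})
    \<le> real N / subset_sum P (\<lambda>p. real (card (\<Omega> p)) / (real p - real (card (\<Omega> p)))) D + D ^ 6"
proof -
  \<comment> \<open>Here \<open>g p\<close> is the proportion of removed classes and
    \<open>h p\<close> equals g/(1 - g); \<open>gg\<close> and \<open>hh\<close> are their
    multiplicative extensions.\<close>
  define g where "g = (\<lambda>p. real (card (\<Omega> p)) / real p)"
  define h where "h = (\<lambda>p. real (card (\<Omega> p)) / (real p - real (card (\<Omega> p))))"
  define gg where "gg = (\<lambda>S. \<Prod>p\<in>S. g p)"
  define hh where "hh = (\<lambda>S. \<Prod>p\<in>S. h p)"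
  define F where "F = {S. S \<subseteq> P \<and> real (\<Prod>S) \<le> D}"
  define J where "J = (\<Sum>S\<in>F. hh S)"
  have J_eq: "J = subset_sum P h D" unfolding J_def subset_sum_def F_def hh_def ..
  have g_pos: "g p > 0" if "p \<in> P" for p using \<Omega>[OF that] by (auto simp: g_def)
  have h_pos: "h p > 0" if "p \<in> P" for p using \<Omega>[OF that] by (auto simp: h_def)
  have gh: "1 + 1 / h p = 1 / g p" if "p \<in> P" for p
    using \<Omega>[OF that] by (simp add: g_def h_def field_simps)
  have finF: "finite F" using P(1) by (auto simp: F_def intro: finite_subset[of _ "Pow P"])
  have FP: "S \<subseteq> P" "finite S" if "S \<in> F" for S
    using that P(1) finite_subset by (auto simp: F_def)
  have gg_pos: "gg S > 0" if "S \<subseteq> P" for S unfolding gg_def using g_pos that by (intro prod_pos) auto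
  have hh_pos: "hh S > 0" if "S \<subseteq> P" for S unfolding hh_def using h_pos that by (intro prod_pos) auto
  have J1: "J \<ge> 1" unfolding J_eq using P(1) h_pos D by (intro subset_sum_ge_1) (auto simp: less_imp_le)
  \<comment> \<open>Closure under subsets lets the inner sums run over complete intervals of the
    subset lattice, both in the inversion and in the formula for unions.\<close>
  have F_down: "S \<in> F" if "T \<in> F" "S \<subseteq> T" for S T
  proof -
    have "\<Prod>S \<le> \<Prod>T"
    proof (rule dvd_imp_le)
      show "\<Prod>S dvd \<Prod>T" using FP(2)[OF that(1)] that(2) by (intro prod_dvd_prod_subset) auto
      show "0 < \<Prod>T" using FP(1)[OF that(1)] P(2) by (intro prod_pos) (auto simp: prime_gt_0_nat)
    qed
    then have "real (\<Prod>S) \<le> real (\<Prod>T)" by (rule of_nat_mono)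
    then show ?thesis using that unfolding F_def mem_Collect_eq by (meson order_trans)
  qed
  \<comment> \<open>Selberg's weights, which diagonalise and minimise the quadratic form below.\<close>
  define lam where "lam = (\<lambda>S. (-1) ^ card S / (J * gg S) * (\<Sum>T | T \<in> F \<and> S \<subseteq> T. hh T))"
  have lam_empty: "lam {} = 1"
    using J1 by (simp add: lam_def gg_def J_def)
  have lam_bound: "\<bar>lam S\<bar> \<le> D" if S: "S \<in> F" for S
  proof -
    have SP: "S \<subseteq> P" using FP S by auto
    have 1: "(\<Sum>T | T \<in> F \<and> S \<subseteq> T. hh T) \<le> J" unfolding J_def
      using finF hh_pos FP by (intro sum_mono2) (auto simp: less_imp_le)
    have 2: "0 \<le> (\<Sum>T | T \<in> F \<and> S \<subseteq> T. hh T)"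
      using hh_pos FP by (intro sum_nonneg) (auto simp: less_imp_le)
    have "1 / gg S = (\<Prod>p\<in>S. 1 / g p)" unfolding gg_def by (simp add: prod_dividef)
    also have "\<dots> \<le> (\<Prod>p\<in>S. real p)"
    proof (rule prod_mono)
      fix p assume "p \<in> S"
      then have p: "p \<in> P" using SP by auto
      then have "real p * 1 \<le> real p * real (card (\<Omega> p))" using \<Omega>[OF p] by (intro mult_left_mono) auto
      then show "0 \<le> 1 / g p \<and> 1 / g p \<le> real p"
        using \<Omega>[OF p] by (simp add: g_def field_simps)
    qed
    also have "\<dots> \<le> D" using S by (simp add: F_def)
    finally have 3: "1 / gg S \<le> D" .
    have "\<bar>lam S\<bar> = 1 / gg S * ((\<Sum>T | T \<in> F \<and> S \<subseteq> T. hh T) / J)"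
      using gg_pos[OF SP] J1 2 by (simp add: lam_def abs_mult power_abs)
    also have "\<dots> \<le> D * 1"
      using 1 2 3 J1 D gg_pos[OF SP] by (intro mult_mono) auto
    finally show ?thesis by simp
  qed
  \<comment> \<open>These are the variables in which the form becomes diagonal. After exchanging the
    sums, the signs of the S between K and T cancel unless K = T.\<close>
  have y: "(\<Sum>S | S \<in> F \<and> K \<subseteq> S. lam S * gg S) = (-1) ^ card K * hh K / J" if K: "K \<in> F" for K
  proof -
    have "(\<Sum>S | S \<in> F \<and> K \<subseteq> S. lam S * gg S)
        = (\<Sum>S | S \<in> F \<and> K \<subseteq> S. \<Sum>T | T \<in> F \<and> S \<subseteq> T. (-1) ^ card S * hh T / J)"
    proof (rule sum.cong[OF refl])
      fix S assume "S \<in> {S. S \<in> F \<and> K \<subseteq> S}"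
      then have "gg S > 0" using gg_pos FP by auto
      then show "lam S * gg S = (\<Sum>T | T \<in> F \<and> S \<subseteq> T. (-1) ^ card S * hh T / J)"
        using J1 by (simp add: lam_def flip: sum_divide_distrib sum_distrib_left)
    qed
    also have "\<dots> = (\<Sum>T\<in>F. \<Sum>S | S \<in> {S \<in> F. K \<subseteq> S} \<and> S \<subseteq> T. (-1) ^ card S * hh T / J)"
      using sum.swap_restrict[of "{S \<in> F. K \<subseteq> S}" F "\<lambda>S T. (-1) ^ card S * hh T / J" "\<lambda>S T. S \<subseteq> T"] finF
      by simp
    also have "\<dots> = (\<Sum>T\<in>F. if K = T then (-1) ^ card K * hh K / J else 0)"
    proof (rule sum.cong[OF refl])
      fix T assume T: "T \<in> F"
      have "{S. S \<in> {S \<in> F. K \<subseteq> S} \<and> S \<subseteq> T} = {S. K \<subseteq> S \<and> S \<subseteq> T}" using F_down[OF T] by auto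
      then have "(\<Sum>S | S \<in> {S \<in> F. K \<subseteq> S} \<and> S \<subseteq> T. (-1) ^ card S * hh T / J)
         = (\<Sum>S | K \<subseteq> S \<and> S \<subseteq> T. (-1) ^ card S) * (hh T / J)"
        by (simp add: sum_distrib_right sum_divide_distrib)
      then show "(\<Sum>S | S \<in> {S \<in> F. K \<subseteq> S} \<and> S \<subseteq> T. (-1) ^ card S * hh T / J)
         = (if K = T then (-1) ^ card K * hh K / J else 0)"
        using sum_Pow_between[OF FP(2)[OF T], of K] by simp
    qed
    also have "\<dots> = (-1) ^ card K * hh K / J" using finF K by simp
    finally show ?thesis .
  qed
  \<comment> \<open>S \<union> T stands for the lcm and S \<inter> T for the gcd. Writing 1/g as 1 +
    1/h and multiplying out over the intersection separates S from T.\<close>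
  have gg_Un: "gg (S \<union> T) = gg S * gg T * (\<Sum>K | K \<in> F \<and> K \<subseteq> S \<and> K \<subseteq> T. 1 / hh K)"
    if S: "S \<in> F" and T: "T \<in> F" for S T
  proof -
    have fin: "finite (S \<inter> T)" and sub: "S \<inter> T \<subseteq> P" using FP S T by auto
    have "{K. K \<in> F \<and> K \<subseteq> S \<and> K \<subseteq> T} = Pow (S \<inter> T)" using F_down S by auto
    then have "(\<Sum>K | K \<in> F \<and> K \<subseteq> S \<and> K \<subseteq> T. 1 / hh K) = (\<Sum>K\<in>Pow (S \<inter> T). \<Prod>p\<in>K. 1 / h p)"
      by (simp add: hh_def prod_dividef)
    also have "\<dots> = (\<Prod>p\<in>S \<inter> T. 1 / h p + 1)"
      using prod_add[OF fin, of "\<lambda>p. 1 / h p" "\<lambda>_. 1"] by simp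
    also have "\<dots> = (\<Prod>p\<in>S \<inter> T. 1 / g p)" using gh sub by (intro prod.cong) (auto simp: add.commute)
    also have "\<dots> = 1 / gg (S \<inter> T)" by (simp add: gg_def prod_dividef)
    finally have "(\<Sum>K | K \<in> F \<and> K \<subseteq> S \<and> K \<subseteq> T. 1 / hh K) = 1 / gg (S \<inter> T)" .
    moreover have "gg (S \<union> T) * gg (S \<inter> T) = gg S * gg T"
      unfolding gg_def using FP S T by (intro prod.union_inter) auto
    ultimately show ?thesis using gg_pos[OF sub] by (metis eq_divide_eq less_irrefl mult.right_neutral times_divide_eq_right)
  qed
  have quad: "(\<Sum>S\<in>F. \<Sum>T\<in>F. lam S * lam T * gg (S \<union> T)) = 1 / J"
  proof -
    have "(\<Sum>S\<in>F. \<Sum>T\<in>F. lam S * lam T * gg (S \<union> T))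
       = (\<Sum>S\<in>F. \<Sum>T\<in>F. \<Sum>K\<in>F. (if K \<subseteq> S then lam S * gg S else 0) * (if K \<subseteq> T then lam T * gg T else 0) * (1 / hh K))"
    proof (intro sum.cong refl)
      fix S T assume "S \<in> F" "T \<in> F"
      then have "lam S * lam T * gg (S \<union> T) = (\<Sum>K | K \<in> F \<and> K \<subseteq> S \<and> K \<subseteq> T. lam S * gg S * (lam T * gg T) * (1 / hh K))"
        by (simp add: gg_Un sum_distrib_left mult_ac)
      also have "\<dots> = (\<Sum>K\<in>F. if K \<subseteq> S \<and> K \<subseteq> T then lam S * gg S * (lam T * gg T) * (1 / hh K) else 0)"
        using finF by (rule sum.inter_filter)
      also have "\<dots> = (\<Sum>K\<in>F. (if K \<subseteq> S then lam S * gg S else 0) * (if K \<subseteq> T then lam T * gg T else 0) * (1 / hh K))"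
        by (intro sum.cong) auto
      finally show "lam S * lam T * gg (S \<union> T) = \<dots>" .
    qed
    also have "\<dots> = (\<Sum>S\<in>F. \<Sum>K\<in>F. \<Sum>T\<in>F. (if K \<subseteq> S then lam S * gg S else 0) * (if K \<subseteq> T then lam T * gg T else 0) * (1 / hh K))"
      by (intro sum.cong refl sum.swap)
    also have "\<dots> = (\<Sum>K\<in>F. \<Sum>S\<in>F. \<Sum>T\<in>F. (if K \<subseteq> S then lam S * gg S else 0) * (if K \<subseteq> T then lam T * gg T else 0) * (1 / hh K))"
      by (rule sum.swap)
    also have "\<dots> = (\<Sum>K\<in>F. (\<Sum>S\<in>F. if K \<subseteq> S then lam S * gg S else 0)\<^sup>2 * (1 / hh K))"
      by (simp only: power2_eq_square sum_product) (simp only: sum_distrib_right)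
    also have "\<dots> = (\<Sum>K\<in>F. hh K / J\<^sup>2)"
    proof (rule sum.cong[OF refl])
      fix K assume K: "K \<in> F"
      then have "(\<Sum>S\<in>F. if K \<subseteq> S then lam S * gg S else 0) = (-1) ^ card K * hh K / J"
        using y[OF K] sum.inter_filter[OF finF, of "\<lambda>S. lam S * gg S" "\<lambda>S. K \<subseteq> S"] by simp
      then show "(\<Sum>S\<in>F. if K \<subseteq> S then lam S * gg S else 0)\<^sup>2 * (1 / hh K) = hh K / J\<^sup>2"
        using hh_pos[OF FP(1)[OF K]] J1
        by (simp add: power_divide power_mult_distrib power2_eq_square flip: power_mult_distrib)
    qed
    also have "\<dots> = J / J\<^sup>2" by (simp add: J_def sum_divide_distrib)
    finally show ?thesis using J1 by (simp add: power2_eq_square)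
  qed
  define A where "A = (\<lambda>S. {t \<in> {..<N}. \<forall>p\<in>S. t mod p \<in> \<Omega> p})"
  define ind where "ind = (\<lambda>S t. if \<forall>p\<in>S. t mod p \<in> \<Omega> p then (1::real) else 0)"
  have ind_mult: "ind S t * ind T t = ind (S \<union> T) t" for S T t by (auto simp: ind_def)
  have sum_ind: "(\<Sum>t<N. ind S t) = real (card (A S))" for S
    unfolding ind_def A_def by (subst sum.If_cases) (auto simp: Int_def)
  have "real (card {t \<in> {..<N}. \<forall>p\<in>P. t mod p \<notin> \<Omega> p})
      = (\<Sum>t<N. if \<forall>p\<in>P. t mod p \<notin> \<Omega> p then 1 else 0)"
    by (subst sum.If_cases) (auto simp: Int_def)
  \<comment> \<open>For a surviving t every nonempty S contributes 0, so the square is that of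
    \<open>lam {}\<close>, which is 1; for all other t a square is nonnegative.\<close>
  also have "\<dots> \<le> (\<Sum>t<N. (\<Sum>S\<in>F. lam S * ind S t)\<^sup>2)"
  proof (rule sum_mono)
    fix t
    show "(if \<forall>p\<in>P. t mod p \<notin> \<Omega> p then 1 else 0) \<le> (\<Sum>S\<in>F. lam S * ind S t)\<^sup>2"
    proof (cases "\<forall>p\<in>P. t mod p \<notin> \<Omega> p")
      case True
      have "lam S * ind S t = (if S = {} then 1 else 0)" if "S \<in> F" for S
        using FP[OF that] True lam_empty by (auto simp: ind_def)
      then have "(\<Sum>S\<in>F. lam S * ind S t) = (\<Sum>S\<in>F. if S = {} then 1 else 0)" by (intro sum.cong) auto
      also have "\<dots> = 1" using finF D by (simp add: F_def)
      finally show ?thesis by simp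
    next
      case False
      then show ?thesis by (simp only: if_False zero_le_power2)
    qed
  qed
  also have "\<dots> = (\<Sum>t<N. \<Sum>S\<in>F. \<Sum>T\<in>F. lam S * lam T * ind (S \<union> T) t)"
    by (simp add: power2_eq_square sum_product mult_ac flip: ind_mult)
  also have "\<dots> = (\<Sum>S\<in>F. \<Sum>t<N. \<Sum>T\<in>F. lam S * lam T * ind (S \<union> T) t)" by (rule sum.swap)
  also have "\<dots> = (\<Sum>S\<in>F. \<Sum>T\<in>F. \<Sum>t<N. lam S * lam T * ind (S \<union> T) t)"
    by (intro sum.cong refl sum.swap)
  also have "\<dots> = (\<Sum>S\<in>F. \<Sum>T\<in>F. lam S * lam T * real (card (A (S \<union> T))))"
    by (simp add: sum_ind flip: sum_distrib_left)
  also have "\<dots> \<le> (\<Sum>S\<in>F. \<Sum>T\<in>F. lam S * lam T * gg (S \<union> T) * N + D ^ 4)"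
  proof (intro sum_mono)
    fix S T assume S: "S \<in> F" and T: "T \<in> F"
    have SD: "real (\<Prod>S) \<le> D" "real (\<Prod>T) \<le> D" using S T by (auto simp: F_def)
    have "finite (S \<union> T)" "S \<union> T \<subseteq> P" using FP S T by auto
    then have "\<bar>real (card (A (S \<union> T))) - N * gg (S \<union> T)\<bar> \<le> real (\<Prod>(S \<union> T))"
      unfolding A_def gg_def g_def using P(2) \<Omega>(1) by (intro card_residue_classes_approx) blast+
    also have "\<Prod>(S \<union> T) \<le> \<Prod>S * \<Prod>T"
    proof -
      have "\<Prod>(S \<union> T) * 1 \<le> \<Prod>(S \<union> T) * \<Prod>(S \<inter> T)"
      proof (intro mult_left_mono prod_ge_1)
        fix p assume "p \<in> S \<inter> T"
        then show "1 \<le> p" using FP(1)[OF S] P(2) prime_ge_1_nat by auto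
      qed simp
      also have "\<dots> = \<Prod>S * \<Prod>T" using FP S T by (intro prod.union_inter) auto
      finally show ?thesis by simp
    qed
    then have "real (\<Prod>(S \<union> T)) \<le> real (\<Prod>S) * real (\<Prod>T)"
      by (metis of_nat_le_iff of_nat_mult)
    also have "\<dots> \<le> D * D" using SD D by (intro mult_mono) (auto simp del: of_nat_prod)
    finally have R: "\<bar>real (card (A (S \<union> T))) - N * gg (S \<union> T)\<bar> \<le> D * D" .
    have "lam S * lam T * (real (card (A (S \<union> T))) - N * gg (S \<union> T))
        \<le> \<bar>lam S * lam T * (real (card (A (S \<union> T))) - N * gg (S \<union> T))\<bar>" by simp
    also have "\<dots> = \<bar>lam S\<bar> * \<bar>lam T\<bar> * \<bar>real (card (A (S \<union> T))) - N * gg (S \<union> T)\<bar>"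
      by (simp add: abs_mult)
    also have "\<dots> \<le> D * D * (D * D)"
      using lam_bound[OF S] lam_bound[OF T] R D by (intro mult_mono) auto
    also have "\<dots> = D ^ 4" by (simp add: power4_eq_xxxx)
    finally show "lam S * lam T * real (card (A (S \<union> T))) \<le> lam S * lam T * gg (S \<union> T) * N + D ^ 4"
      by (simp add: algebra_simps)
  qed
  also have "\<dots> = (\<Sum>S\<in>F. \<Sum>T\<in>F. lam S * lam T * gg (S \<union> T)) * N + real (card F) * real (card F) * D ^ 4"
    by (simp add: sum.distrib sum_distrib_right)
  also have "\<dots> \<le> 1 / J * N + D * D * D ^ 4"
  proof -
    have "real (card F) \<le> D" unfolding F_def using P D by (intro card_subsets_Prod_le) auto
    then show ?thesis unfolding quad using D by (intro add_left_mono mult_right_mono mult_mono) auto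
  qed
  also have "\<dots> = N / J + D ^ 6" by (simp add: eval_nat_numeral)
  finally show ?thesis unfolding J_eq h_def .
qed

section \<open>Elementary prime number estimates\<close>

lemma harmonic_ge_ln:
  assumes "0 < n"
  shows "ln (real n + 1) \<le> (\<Sum>k\<in>{1..n}. 1 / real k)"
  using assms
proof (induction n rule: nat_induct_non_zero)
  case 1
  have "ln (2::real) \<le> 2 - 1" by (rule ln_le_minus_one) simp
  then show ?case by simp
next
  case (Suc n)
  have "real (Suc n) + 1 = (real n + 1) * (1 + 1 / (real n + 1))" by (simp add: field_simps)
  then have "ln (real (Suc n) + 1) = ln (real n + 1) + ln (1 + 1 / (real n + 1))"
    using ln_mult_pos[of "real n + 1" "1 + 1 / (real n + 1)"] by (simp add: add_pos_pos)
  also have "ln (1 + 1 / (real n + 1)) \<le> 1 / (real n + 1)"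
    by (rule ln_add_one_self_le_self) simp
  finally show ?case using Suc by (simp add: add.commute)
qed

lemma harmonic_le_ln:
  assumes "0 < n"
  shows "(\<Sum>k\<in>{1..n}. 1 / real k) \<le> 1 + ln (real n)"
  using assms
proof (induction n rule: nat_induct_non_zero)
  case (Suc n)
  have "ln (real n / real (Suc n)) \<le> real n / real (Suc n) - 1"
    using Suc by (intro ln_le_minus_one) auto
  also have "\<dots> = - 1 / real (Suc n)" by (simp add: field_simps)
  also have "ln (real n / real (Suc n)) = ln (real n) - ln (real (Suc n))"
    using Suc by (subst ln_div) auto
  finally show ?case using Suc by simp
qed simp

section \<open>The sum of ln p / p, from the prime powers dividing n!\<close>

lemma ln_fact_le: "ln (fact n :: real) \<le> real n * ln (real n)"
proof (cases "n = 0")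
  case False
  have "(fact n :: real) \<le> real n ^ n" using fact_le_power[of n] by simp
  then have "ln (fact n :: real) \<le> ln (real n ^ n)" using False by (subst ln_le_cancel_iff) auto
  then show ?thesis using False by (simp add: ln_realpow)
qed simp

lemma prime_power_div_dvd_fact:
  fixes p n :: nat
  assumes "0 < p"
  shows "p ^ (n div p) dvd fact n"
proof -
  have "p ^ k dvd fact (k * p)" for k
  proof (induction k)
    case (Suc k)
    obtain q where q: "p = Suc q" using assms gr0_implies_Suc by blast
    have "Suc k * p = Suc (k * p + q)" by (simp add: q)
    then have eq: "fact (Suc k * p) = Suc k * p * (fact (k * p + q) :: nat)"
      by (metis fact_Suc of_nat_id)
    have "p ^ k dvd fact (k * p + q)" by (rule dvd_trans[OF Suc fact_dvd]) simp
    then have "p * p ^ k dvd Suc k * p * (fact (k * p + q) :: nat)"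
      by (intro mult_dvd_mono) auto
    then show ?case using eq by simp
  qed simp
  moreover have "fact (n div p * p) dvd (fact n :: nat)" by (rule fact_dvd) simp
  ultimately show ?thesis by (rule dvd_trans)
qed

lemma prod_pairwise_coprime_dvd:
  fixes f :: "'a \<Rightarrow> nat"
  assumes "finite A" "\<And>i. i \<in> A \<Longrightarrow> f i dvd m"
    "\<And>i j. i \<in> A \<Longrightarrow> j \<in> A \<Longrightarrow> i \<noteq> j \<Longrightarrow> coprime (f i) (f j)"
  shows "(\<Prod>i\<in>A. f i) dvd m"
  using assms
proof (induction A rule: finite_induct)
  case (insert a A)
  have "coprime (f a) (\<Prod>i\<in>A. f i)"
    using insert.hyps insert.prems(2) by (intro prod_coprime_right) auto
  then show ?case using insert by (auto intro: divides_mult)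
qed simp

text \<open>The powers p^(n div p) are pairwise coprime divisors of n!, so their product is at most
  n^n. The factor 2 is the price for n div p \<ge> n/(2 p), valid for p \<le> n.\<close>

lemma sum_ln_prime_over_prime_le:
  assumes "0 < n"
  shows "(\<Sum>p | prime p \<and> p \<le> n. ln (real p) / real p) \<le> 2 * ln (real n)"
proof -
  let ?P = "{p. prime p \<and> p \<le> n}"
  have fin: "finite ?P" by simp
  have "(\<Prod>p\<in>?P. p ^ (n div p)) dvd (fact n :: nat)"
  proof (rule prod_pairwise_coprime_dvd[OF fin])
    fix i assume "i \<in> ?P"
    then show "i ^ (n div i) dvd fact n"
      by (intro prime_power_div_dvd_fact) (auto simp: prime_gt_0_nat)
  next
    fix i j assume "i \<in> ?P" "j \<in> ?P" "i \<noteq> j"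
    then show "coprime (i ^ (n div i)) (j ^ (n div j))"
      using primes_coprime by (auto simp: coprime_power_left_iff coprime_power_right_iff)
  qed
  then have "(\<Prod>p\<in>?P. p ^ (n div p)) \<le> (fact n :: nat)" by (rule dvd_imp_le) simp
  then have "real (\<Prod>p\<in>?P. p ^ (n div p)) \<le> real (fact n)" by (rule of_nat_mono)
  then have "(\<Prod>p\<in>?P. real p ^ (n div p)) \<le> fact n" by simp
  then have "ln (\<Prod>p\<in>?P. real p ^ (n div p)) \<le> ln (fact n)"
    by (subst ln_le_cancel_iff) (auto intro!: prod_pos simp: prime_gt_0_nat)
  also have "ln (\<Prod>p\<in>?P. real p ^ (n div p)) = (\<Sum>p\<in>?P. real (n div p) * ln (real p))"
    by (subst ln_prod) (auto simp: ln_realpow prime_gt_0_nat)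
  finally have 1: "(\<Sum>p\<in>?P. real (n div p) * ln (real p)) \<le> real n * ln (real n)"
    using ln_fact_le[of n] by linarith
  have "(\<Sum>p\<in>?P. real n / (2 * real p) * ln (real p)) \<le> (\<Sum>p\<in>?P. real (n div p) * ln (real p))"
  proof (rule sum_mono)
    fix p assume "p \<in> ?P"
    then have p: "prime p" "p \<le> n" "0 < p" by (auto simp: prime_gt_0_nat)
    have "0 < n div p" using p by (simp add: div_greater_zero_iff)
    then have "p * 1 \<le> p * (n div p)" by (intro mult_left_mono) auto
    moreover have "n = p * (n div p) + n mod p" "n mod p < p" using p by auto
    ultimately have "n \<le> 2 * (p * (n div p))" by linarith
    then have "real n \<le> real (2 * (p * (n div p)))" by (rule of_nat_mono)
    then have "real n / (2 * real p) \<le> real (n div p)" using p by (simp add: field_simps)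
    then show "real n / (2 * real p) * ln (real p) \<le> real (n div p) * ln (real p)"
      using p by (intro mult_right_mono) auto
  qed
  also have "(\<Sum>p\<in>?P. real n / (2 * real p) * ln (real p)) = real n / 2 * (\<Sum>p\<in>?P. ln (real p) / real p)"
    by (simp add: sum_distrib_left)
  finally have "real n / 2 * (\<Sum>p\<in>?P. ln (real p) / real p) \<le> real n * ln (real n)" using 1 by linarith
  then have "real n * (\<Sum>p\<in>?P. ln (real p) / real p) \<le> real n * (2 * ln (real n))" by simp
  then show ?thesis using assms by (subst (asm) mult_le_cancel_left_pos) auto
qed


section \<open>An upper bound for Mertens' product, from the zeta function to the right of 1\<close>

text \<open>Each term with m \<ge> 2 is at most the decrease of x^(-\<delta>)/\<delta> from m - 1 to
  m, as in comparison with an integral. The negative term makes the induction close; without it the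
  bound is the usual 1 + 1/\<delta> for zeta at 1 + \<delta>.\<close>

lemma sum_powr_le:
  assumes "\<delta> > 0" "0 < n"
  shows "(\<Sum>m\<in>{1..n}. real m powr (-1 - \<delta>)) \<le> 1 + 1 / \<delta> - real n powr (-\<delta>) / \<delta>"
  using assms(2)
proof (induction n rule: nat_induct_non_zero)
  case (Suc n)
  define y where "y = real (Suc n)"
  have y: "y > 1" "real n = y * (1 - 1 / y)" "1 - 1 / y > 0"
    using Suc by (auto simp: y_def field_simps)
  have "1 + \<delta> / y \<le> exp (\<delta> / y)" by (rule exp_ge_add_one_self)
  also have "\<delta> / y \<le> - \<delta> * ln (1 - 1 / y)"
  proof -
    have "ln (1 - 1 / y) \<le> - (1 / y)" using ln_le_minus_one[OF y(3)] by simp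
    then have "\<delta> * ln (1 - 1 / y) \<le> \<delta> * - (1 / y)" using assms(1) by (intro mult_left_mono) auto
    then show ?thesis by simp
  qed
  then have "exp (\<delta> / y) \<le> exp (- \<delta> * ln (1 - 1 / y))" by simp
  also have "\<dots> = (1 - 1 / y) powr (- \<delta>)" using y by (simp add: powr_def)
  finally have "y powr (- \<delta>) * (1 + \<delta> / y) \<le> y powr (- \<delta>) * (1 - 1 / y) powr (- \<delta>)"
    by (intro mult_left_mono) auto
  also have "\<dots> = real n powr (- \<delta>)" using y by (simp only: powr_mult)
  finally have "y powr (- \<delta>) / y \<le> (real n powr (- \<delta>) - y powr (- \<delta>)) / \<delta>"
    using assms(1) by (simp add: field_simps)
  also have "y powr (- \<delta>) / y = y powr (-1 - \<delta>)"
    using y powr_add[of y "-\<delta>" "-1"] by (simp add: powr_minus divide_inverse algebra_simps)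
  finally show ?case using Suc by (simp add: y_def diff_divide_distrib)
qed simp

text \<open>Multiplying out truncated geometric series produces every integer at most once: the
  exponent of the newly inserted prime is recovered as its multiplicity. Truncation at K keeps
  everything finite, and K tends to infinity only afterwards.\<close>

lemma euler_product_partial:
  fixes f :: "nat \<Rightarrow> real"
  assumes "finite P" "\<And>p. p \<in> P \<Longrightarrow> prime p"
    and mult: "\<And>m n. f (m * n) = f m * f n" and "f 1 = 1"
  shows "\<exists>A. finite A \<and> 0 \<notin> A \<and> (\<forall>m\<in>A. \<forall>q. prime q \<longrightarrow> q dvd m \<longrightarrow> q \<in> P) \<and>
           (\<Prod>p\<in>P. \<Sum>k<K. f p ^ k) = (\<Sum>m\<in>A. f m)"
  using assms(1,2)
proof (induction P rule: finite_induct)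
  case empty
  have "\<forall>q::nat. prime q \<longrightarrow> \<not> q dvd 1" using prime_nat_iff by auto
  then show ?case using assms(4) by (intro exI[of _ "{1}"]) auto
next
  case (insert p P)
  then obtain A where A: "finite A" "0 \<notin> A" "\<And>m q. m \<in> A \<Longrightarrow> prime q \<Longrightarrow> q dvd m \<Longrightarrow> q \<in> P"
    "(\<Prod>p\<in>P. \<Sum>k<K. f p ^ k) = (\<Sum>m\<in>A. f m)" by auto
  have p: "prime p" "p \<noteq> 0" using insert.prems prime_gt_0_nat[of p] by auto
  have pow: "f (q ^ k) = f q ^ k" for q k using assms(4) by (induction k) (auto simp: mult)
  let ?g = "\<lambda>(k, m). p ^ k * m"
  have multp: "multiplicity p (p ^ k * m) = k" if "m \<in> A" for k m
  proof -
    have "\<not> p dvd m" using A(3)[OF that p(1)] insert.hyps by auto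
    moreover have "m \<noteq> 0" using A(2) that by metis
    ultimately show ?thesis
      using p by (subst prime_elem_multiplicity_mult_distrib)
        (auto simp: not_dvd_imp_multiplicity_0 multiplicity_same_power)
  qed
  have inj: "inj_on ?g ({..<K} \<times> A)"
  proof (rule inj_onI, clarify)
    fix k m k' m' assume *: "m \<in> A" "m' \<in> A" "p ^ k * m = p ^ k' * m'"
    then have "k = k'" using multp by metis
    then show "k = k' \<and> m = m'" using * p by auto
  qed
  have "(\<Prod>p\<in>insert p P. \<Sum>k<K. f p ^ k) = (\<Sum>k<K. f p ^ k) * (\<Sum>m\<in>A. f m)"
    using insert.hyps A by simp
  also have "\<dots> = (\<Sum>(k, m)\<in>{..<K} \<times> A. f p ^ k * f m)"
    by (simp add: sum_product sum.cartesian_product)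
  also have "\<dots> = (\<Sum>x\<in>?g ` ({..<K} \<times> A). f x)"
    unfolding sum.reindex[OF inj] by (intro sum.cong) (auto simp: mult pow)
  finally have "(\<Prod>p\<in>insert p P. \<Sum>k<K. f p ^ k) = (\<Sum>x\<in>?g ` ({..<K} \<times> A). f x)" .
  moreover have "finite (?g ` ({..<K} \<times> A))" "0 \<notin> ?g ` ({..<K} \<times> A)" using A p by auto
  moreover have "q \<in> insert p P" if q: "m \<in> ?g ` ({..<K} \<times> A)" "prime q" "q dvd m" for m q
  proof -
    obtain k n where kn: "m = p ^ k * n" "n \<in> A" using q(1) by auto
    then have "q dvd p ^ k \<or> q dvd n" using q by (simp add: prime_dvd_mult_iff)
    then show ?thesis
    proof
      assume "q dvd p ^ k"
      then have "q dvd p" using q prime_dvd_power by blast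
      then show ?thesis using q p primes_dvd_imp_eq by blast
    qed (use A(3) kn q in auto)
  qed
  ultimately show ?case by (intro exI[of _ "?g ` ({..<K} \<times> A)"] conjI ballI allI impI) (simp_all only: not_False_eq_True)
qed

lemma euler_product_le:
  assumes "finite P" "\<And>p. p \<in> P \<Longrightarrow> prime (p::nat)" "\<delta> > 0"
  shows "(\<Prod>p\<in>P. 1 / (1 - real p powr (-1 - \<delta>))) \<le> 1 + 1 / \<delta>"
proof -
  define f where "f = (\<lambda>m. real m powr (-1 - \<delta>))"
  have "(\<lambda>K. \<Prod>p\<in>P. \<Sum>k<K. f p ^ k) \<longlonglongrightarrow> (\<Prod>p\<in>P. 1 / (1 - f p))"
  proof (rule tendsto_prod)
    fix p assume "p \<in> P"
    then have "1 < real p" using assms(2) prime_gt_1_nat by auto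
    then have "f p < 1" using powr_less_cancel_iff[of "real p" "-1 - \<delta>" 0] assms(3) unfolding f_def by simp
    then have "norm (f p) < 1" unfolding f_def by simp
    then show "(\<lambda>K. \<Sum>k<K. f p ^ k) \<longlonglongrightarrow> 1 / (1 - f p)"
      using geometric_sums[of "f p"] unfolding sums_def by simp
  qed
  moreover have "(\<Prod>p\<in>P. \<Sum>k<K. f p ^ k) \<le> 1 + 1 / \<delta>" for K
  proof -
    have "f (m * n) = f m * f n" for m n by (simp add: f_def powr_mult)
    moreover have "f 1 = 1" by (simp add: f_def)
    ultimately obtain A where A: "finite A" "0 \<notin> A" "(\<Prod>p\<in>P. \<Sum>k<K. f p ^ k) = (\<Sum>m\<in>A. f m)"
      using euler_product_partial[OF assms(1,2), of f K] by metis
    have "A \<subseteq> {1..Suc (Max A)}"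
      using A by (auto simp: Suc_le_eq intro!: le_SucI) (metis gr0I)
    then have "(\<Sum>m\<in>A. f m) \<le> (\<Sum>m\<in>{1..Suc (Max A)}. f m)"
      by (intro sum_mono2) (auto simp: f_def)
    also have "\<dots> \<le> 1 + 1 / \<delta> - real (Suc (Max A)) powr (-\<delta>) / \<delta>"
      unfolding f_def by (rule sum_powr_le[OF assms(3)]) simp
    also have "\<dots> \<le> 1 + 1 / \<delta>" using assms(3) by simp
    finally show ?thesis using A by simp
  qed
  ultimately have "(\<Prod>p\<in>P. 1 / (1 - f p)) \<le> 1 + 1 / \<delta>" by (intro LIMSEQ_le_const2) auto
  then show ?thesis unfolding f_def .
qed

text \<open>Replacing \<open>1/p\<close> by \<open>p powr (-1 - \<delta>)\<close> with \<open>\<delta> = 1 / ln n\<close> changes the product by a bounded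
  factor only, and the modified product is bounded by the zeta function at \<open>1 + \<delta>\<close>.\<close>

lemma mertens_product_le:
  assumes "2 \<le> n"
  shows "(\<Prod>p | prime p \<and> p \<le> n. 1 + 1 / (real p - 1)) \<le> exp 4 * (1 + ln (real n))"
proof -
  let ?P = "{p::nat. prime p \<and> p \<le> n}"
  have fin: "finite ?P" by simp
  define \<delta> where "\<delta> = 1 / ln (real n)"
  have lnn: "ln (real n) > 0" using assms by simp
  then have \<delta>: "\<delta> > 0" by (simp add: \<delta>_def)
  have "(\<Prod>p\<in>?P. 1 + 1 / (real p - 1)) \<le> (\<Prod>p\<in>?P. exp (2 * \<delta> * (ln (real p) / real p)) * (1 / (1 - real p powr (-1 - \<delta>))))"
  proof (rule prod_mono)
    fix p assume "p \<in> ?P"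
    then have p: "real p \<ge> 2" using prime_ge_2_nat by auto
    define t where "t = real p powr (-1 - \<delta>)"
    have t: "t = 1 / real p * exp (- (\<delta> * ln (real p)))"
      using p unfolding t_def powr_def by (simp add: algebra_simps exp_diff exp_minus divide_inverse)
    have e: "1 - exp (- (\<delta> * ln (real p))) \<le> \<delta> * ln (real p)"
      using exp_ge_add_one_self[of "- (\<delta> * ln (real p))"] by simp
    have "exp (- (\<delta> * ln (real p))) \<le> 1" using \<delta> p by simp
    then have "t \<le> 1 / real p * 1" using p unfolding t by (intro mult_left_mono) auto
    moreover have "1 / real p < 1" using p by simp
    ultimately have tp: "t \<le> 1 / real p" "t < 1" by linarith+
    \<comment> \<open>The quotient of the Euler factors for 1/p and for t is written as 1 + (1/p -
      t) p/(p - 1); here p/(p - 1) \<le> 2 and 1/p - t \<le> \<delta> ln p / p.\<close>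
    have "(1 - t) * real p / (real p - 1) = 1 + (1 / real p - t) * (real p / (real p - 1))"
      using p by (simp add: field_simps)
    also have "\<dots> \<le> 1 + (1 / real p - t) * 2"
      using tp p by (intro add_left_mono mult_left_mono) (auto simp: field_simps)
    also have "\<dots> = 1 + 2 * (1 / real p * (1 - exp (- (\<delta> * ln (real p)))))"
      unfolding t by (simp add: algebra_simps)
    also have "\<dots> \<le> 1 + 2 * (1 / real p * (\<delta> * ln (real p)))"
      using e p by (intro add_left_mono mult_left_mono) auto
    also have "\<dots> \<le> exp (2 * \<delta> * (ln (real p) / real p))"
      using exp_ge_add_one_self[of "2 * \<delta> * (ln (real p) / real p)"] by (simp add: mult_ac)
    finally have "(1 - t) * (real p / (real p - 1)) \<le> exp (2 * \<delta> * (ln (real p) / real p))" by simp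
    moreover have "1 + 1 / (real p - 1) = real p / (real p - 1)" using p by (simp add: field_simps)
    ultimately have "1 + 1 / (real p - 1) \<le> exp (2 * \<delta> * (ln (real p) / real p)) * (1 / (1 - t))"
      using tp p by (simp add: field_simps)
    then show "0 \<le> 1 + 1 / (real p - 1) \<and> 1 + 1 / (real p - 1)
        \<le> exp (2 * \<delta> * (ln (real p) / real p)) * (1 / (1 - real p powr (-1 - \<delta>)))"
      using p by (simp add: t_def)
  qed
  also have "\<dots> = exp (2 * \<delta> * (\<Sum>p\<in>?P. ln (real p) / real p)) * (\<Prod>p\<in>?P. 1 / (1 - real p powr (-1 - \<delta>)))"
    by (simp only: prod.distrib exp_sum[OF fin] sum_distrib_left)
  also have "\<dots> \<le> exp 4 * (1 + 1 / \<delta>)"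
  proof (rule mult_mono)
    \<comment> \<open>The constant 4 is 2 \<delta> times the bound 2 ln n, with \<delta> ln n =
      1.\<close>
    have "2 * \<delta> * (\<Sum>p\<in>?P. ln (real p) / real p) \<le> 2 * \<delta> * (2 * ln (real n))"
      using sum_ln_prime_over_prime_le[of n] assms \<delta> by (intro mult_left_mono) auto
    also have "\<dots> = 4" using lnn by (simp add: \<delta>_def)
    finally show "exp (2 * \<delta> * (\<Sum>p\<in>?P. ln (real p) / real p)) \<le> exp 4" by simp
    show "(\<Prod>p\<in>?P. 1 / (1 - real p powr (-1 - \<delta>))) \<le> 1 + 1 / \<delta>"
      using \<delta> by (intro euler_product_le) auto
    show "0 \<le> (\<Prod>p\<in>?P. 1 / (1 - real p powr (-1 - \<delta>)))"
    proof (rule prod_nonneg)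
      fix p assume "p \<in> ?P"
      then have "1 < real p" using prime_gt_1_nat by auto
      then have "real p powr (-1 - \<delta>) \<le> 1"
        using powr_mono[of "-1 - \<delta>" 0 "real p"] \<delta> by simp
      then show "0 \<le> 1 / (1 - real p powr (-1 - \<delta>))" by simp
    qed
  qed simp
  finally show ?thesis by (simp add: \<delta>_def)
qed


section \<open>Chebyshev's lower bound, from the least common multiple of 1, ..., n\<close>

text \<open>The numbers (n + 1) binom(n, j) are the denominators of the Leibniz harmonic triangle.
  If L/a and L/c are integers and 1/b = 1/c - 1/a, then L/b is an integer too; so divisibility
  passes along row n + 1 from the previous entry and from row n.\<close>

lemma Suc_times_binomial_dvd_Lcm:
  assumes "j \<le> n"
  shows "Suc n * (n choose j) dvd Lcm {1..Suc n}"
  using assms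
proof (induction n arbitrary: j)
  case 0
  then show ?case by simp
next
  case (Suc n)
  let ?n = "Suc n" and ?L = "Lcm {1..Suc (Suc n)}"
  have "Lcm {1..?n} dvd ?L" by (rule Lcm_subset) auto
  then have IH: "?n * (n choose j) dvd ?L" if "j \<le> n" for j using Suc.IH[OF that] dvd_trans by blast
  show ?case using Suc.prems
  proof (induction j)
    case 0
    have "Suc ?n dvd ?L" by (rule dvd_Lcm) simp
    then show ?case by simp
  next
    case (Suc j)
    define a where "a = Suc ?n * (?n choose j)"
    define b where "b = Suc ?n * (?n choose Suc j)"
    define c where "c = ?n * (n choose j)"
    have "a dvd ?L" "c dvd ?L" using Suc IH by (auto simp: a_def c_def)
    then obtain x y where xy: "?L = a * x" "?L = c * y" unfolding dvd_def by blast
    have c: "c = Suc j * (?n choose Suc j)" "c = (?n - j) * (?n choose j)"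
      using times_binomial_minus1_eq[of "Suc j" ?n] binomial_absorb_comp[of ?n j] by (auto simp: c_def)
    \<comment> \<open>\<open>1/b = 1/c - 1/a\<close> is the recurrence of the Leibniz harmonic triangle.\<close>
    have eq: "int b * (int a - int c) = int a * int c"
    proof -
      have j: "int (?n - j) = int ?n - int j" using Suc.prems by simp
      have "int a - int c = (int j + 1) * int (?n choose j)"
        unfolding a_def c(2) of_nat_mult j by (simp add: algebra_simps del: binomial_Suc_Suc)
      then have "int b * (int a - int c) = int a * ((int j + 1) * int (?n choose Suc j))"
        unfolding a_def b_def by (simp only: of_nat_mult mult_ac)
      also have "(int j + 1) * int (?n choose Suc j) = int c" unfolding c(1) by (simp only: of_nat_mult of_nat_Suc add.commute)
      finally show ?thesis .
    qed
    have "0 < ?n choose j" "0 < n choose j" using Suc.prems by (auto intro: zero_less_binomial)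
    then have pos: "int a > 0" "int c > 0" unfolding a_def c_def of_nat_0_less_iff by (simp_all only: nat_0_less_mult_iff zero_less_Suc)
    have L: "int ?L = int a * int x" "int ?L = int c * int y" using xy by (metis of_nat_mult)+
    have "int b * (int y - int x) * (int a * int c) = int b * (int a * (int c * int y) - int c * (int a * int x))"
      by (simp add: algebra_simps)
    also have "\<dots> = int b * (int a * int ?L - int c * int ?L)" by (simp only: L(1)[symmetric] L(2)[symmetric])
    also have "\<dots> = int b * (int a - int c) * int ?L" by (simp only: left_diff_distrib mult.assoc)
    also have "\<dots> = int ?L * (int a * int c)" using eq by (simp only: mult.commute)
    finally have "int ?L = int b * (int y - int x)" using pos by simp
    then have "int b dvd int ?L" by simp
    then show ?case unfolding b_def by (simp only: of_nat_dvd_iff)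
  qed
qed

lemma prime_power_dvd_Lcm:
  assumes "finite A" "0 \<notin> A" "prime (p::nat)" "0 < k" "p ^ k dvd Lcm A"
  shows "\<exists>a\<in>A. p ^ k dvd a"
  using assms
proof (induction A rule: finite_induct)
  case empty
  then show ?case by (auto dest: prime_gt_1_nat)
next
  case (insert a A)
  have p: "p \<noteq> 0" "\<not> is_unit p" using insert.prems by auto
  have nz: "a \<noteq> 0" "Lcm A \<noteq> 0" using insert by (auto simp: Lcm_0_iff)
  have "k \<le> multiplicity p (lcm a (Lcm A))"
    using insert.prems p nz by (subst power_dvd_iff_le_multiplicity[symmetric]) (auto simp: lcm_eq_0_iff)
  also have "\<dots> = max (multiplicity p a) (multiplicity p (Lcm A))"
    using nz insert.prems by (intro multiplicity_lcm) auto
  finally have "p ^ k dvd a \<or> p ^ k dvd Lcm A"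
    using multiplicity_dvd' by (auto simp: le_max_iff_disj)
  then show ?case using insert by auto
qed

lemma Lcm_atLeast1_pos: "Lcm {1..n} > (0::nat)"
  using Lcm_0_iff[of "{1..n}"] by (auto intro: Nat.gr0I)

text \<open>The exponent of p in an lcm is attained by one of its arguments. Hence every prime power
  occurring in the factorisation of the lcm divides some number in 1..n and is at most n, and there
  is at most one such power for each prime up to n.\<close>

lemma Lcm_le_power_prime_count:
  fixes n :: nat
  assumes "0 < n"
  shows "Lcm {1..n} \<le> n ^ card {p. prime p \<and> p \<le> n}"
proof -
  let ?L = "Lcm {1..n}"
  have L: "?L > 0" by (rule Lcm_atLeast1_pos)
  have le: "p ^ multiplicity p ?L \<le> n \<and> p \<le> n" if "p \<in> prime_factors ?L" for p
  proof -
    have p: "prime p" "p dvd ?L" using that by auto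
    then have "multiplicity p ?L > 0" using L by (simp add: prime_multiplicity_gt_zero_iff)
    then obtain a where "a \<in> {1..n}" "p ^ multiplicity p ?L dvd a"
      using prime_power_dvd_Lcm[of "{1..n}" p "multiplicity p ?L"] p multiplicity_dvd[of p ?L] by auto
    moreover obtain b where "b \<in> {1..n}" "p ^ 1 dvd b"
      using prime_power_dvd_Lcm[of "{1..n}" p 1] p by auto
    ultimately show ?thesis by (auto dest!: dvd_imp_le)
  qed
  have "?L = (\<Prod>p\<in>prime_factors ?L. p ^ multiplicity p ?L)" using L by (rule prime_factorization_nat)
  also have "\<dots> \<le> (\<Prod>p\<in>prime_factors ?L. n)" 
    by (rule prod_mono) (simp only: le zero_le simp_thms)
  also have "\<dots> = n ^ card (prime_factors ?L)" by simp
  also have "\<dots> \<le> n ^ card {p. prime p \<and> p \<le> n}"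
  proof (intro power_increasing card_mono)
    show "prime_factors ?L \<subseteq> {p. prime p \<and> p \<le> n}" using le in_prime_factors_imp_prime by blast
  qed (use assms in auto)
  finally show ?thesis .
qed

text \<open>The product n binom(2n, n) divides lcm(1, ..., 2n). Its factor n compensates the
  denominator in binom(2n, n) \<ge> 4^n / (2n), which leaves 4^n / 2 \<ge> 2^n.\<close>

lemma chebyshev_lower:
  assumes "0 < n"
  shows "real n * ln 2 / ln (2 * real n) \<le> real (card {p. prime p \<and> p \<le> 2 * n})"
proof -
  let ?k = "card {p. prime p \<and> p \<le> 2 * n}"
  obtain m where m: "2 * n = Suc m" using assms by (metis Suc_pred' nat_0_less_mult_iff zero_less_numeral)
  have "n * (2 * n choose n) = 2 * n * ((2 * n - 1) choose (n - 1))"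
    using times_binomial_minus1_eq[OF assms, of "2 * n"] .
  then have "n * (2 * n choose n) dvd Lcm {1..2 * n}"
    using Suc_times_binomial_dvd_Lcm[of "n - 1" m] m by auto
  then have "n * (2 * n choose n) \<le> Lcm {1..2 * n}" using Lcm_atLeast1_pos by (rule dvd_imp_le)
  also have "\<dots> \<le> (2 * n) ^ ?k" using assms by (intro Lcm_le_power_prime_count) simp
  finally have "real (n * (2 * n choose n)) \<le> real ((2 * n) ^ ?k)" by (rule of_nat_mono)
  then have 1: "real n * real (2 * n choose n) \<le> (2 * real n) ^ ?k" by simp
  have "real n * (4 ^ n / (2 * real n)) \<le> real n * real (2 * n choose n)"
    using central_binomial_lower_bound[OF assms] by (intro mult_left_mono) auto
  then have "4 ^ n / 2 \<le> (2 * real n) ^ ?k" using 1 assms by simp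
  then have "ln (4 ^ n / 2) \<le> ln ((2 * real n) ^ ?k)" using assms by (subst ln_le_cancel_iff) auto
  then have 2: "real n * ln 4 - ln 2 \<le> real ?k * ln (2 * real n)"
    by (simp only: ln_realpow) (simp add: ln_divide_pos ln_realpow)
  have "real n * ln 4 = 2 * (real n * ln 2)" using ln_realpow[of "2::real" 2] by simp
  moreover have "1 * ln 2 \<le> real n * ln 2" using assms by (intro mult_right_mono) auto
  ultimately have "real n * ln 2 \<le> real ?k * ln (2 * real n)" using 2 by linarith
  then show ?thesis using assms by (simp add: field_simps)
qed

section \<open>Sieve densities\<close>

text \<open>As 1/(p - 1) is the sum of p^(-j) over j \<ge> 1, the right-hand side is the sum of 1/k
  over all k built from P whose square-free kernel is at most Y, while on the left k itself is at
  most Y. The proof avoids infinite series by stripping one factor p at a time.\<close>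

lemma harmonic_smooth_le_subset_sum:
  assumes "finite P" "\<And>p. p \<in> P \<Longrightarrow> prime p"
  shows "(\<Sum>k | 0 < k \<and> real k \<le> Y \<and> (\<forall>q. prime q \<longrightarrow> q dvd k \<longrightarrow> q \<in> P). 1 / real k)
    \<le> subset_sum P (\<lambda>p. 1 / (real p - 1)) Y"
  using assms
proof (induction P arbitrary: Y rule: finite_induct)
  case empty
  have "{k. 0 < k \<and> real k \<le> Y \<and> (\<forall>q. prime q \<longrightarrow> q dvd k \<longrightarrow> q \<in> {})} = (if 1 \<le> Y then {1} else {})"
  proof -
    have "(\<forall>q. prime q \<longrightarrow> q dvd k \<longrightarrow> q \<in> {}) \<longleftrightarrow> k = 1" for k :: nat
      using prime_factor_nat[of k] by (auto dest: prime_gt_1_nat)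
    then have "{k. 0 < k \<and> real k \<le> Y \<and> (\<forall>q. prime q \<longrightarrow> q dvd k \<longrightarrow> q \<in> {})} = {k. 0 < k \<and> real k \<le> Y \<and> k = 1}"
      by (simp only:)
    also have "\<dots> = (if 1 \<le> Y then {1} else {})" by auto
    finally show ?thesis .
  qed
  then show ?case by (simp add: subset_sum_empty)
next
  case (insert p P)
  define S where "S = (\<lambda>P Y. {k::nat. 0 < k \<and> real k \<le> Y \<and> (\<forall>q. prime q \<longrightarrow> q dvd k \<longrightarrow> q \<in> P)})"
  define H where "H = (\<lambda>P Y. \<Sum>k\<in>S P Y. 1 / real k)"
  define a where "a = (\<lambda>p. 1 / (real p - 1))"
  have p: "prime p" "2 \<le> real p" using insert.prems prime_ge_2_nat[of p] by auto
  have a_nonneg: "0 \<le> a q" if "q \<in> insert p P" for q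
    using insert.prems[OF that] prime_ge_2_nat[of q] by (auto simp: a_def)
  have finS: "finite (S P Y)" for P Y
    by (rule finite_subset[of _ "{..nat \<lfloor>Y\<rfloor>}"]) (auto simp: S_def le_nat_floor)
  have IH: "H P Y \<le> subset_sum P a Y" for Y
    using insert unfolding H_def S_def a_def by auto
  have rec: "H (insert p P) Y = H P Y + 1 / real p * H (insert p P) (Y / real p)" for Y
  proof -
    have eq: "S (insert p P) Y = S P Y \<union> (\<lambda>k. p * k) ` S (insert p P) (Y / real p)"
    proof (intro equalityI subsetI)
      fix k assume k: "k \<in> S (insert p P) Y"
      show "k \<in> S P Y \<union> (\<lambda>k. p * k) ` S (insert p P) (Y / real p)"
      proof (cases "p dvd k")
        case True
        then obtain j where j: "k = p * j" by (elim dvdE)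
        then have "j \<in> S (insert p P) (Y / real p)"
          using k p by (auto simp: S_def field_simps)
        then show ?thesis using j by blast
      qed (use k in \<open>auto simp: S_def\<close>)
    next
      fix k assume "k \<in> S P Y \<union> (\<lambda>k. p * k) ` S (insert p P) (Y / real p)"
      then show "k \<in> S (insert p P) Y"
      proof
        assume "k \<in> (\<lambda>k. p * k) ` S (insert p P) (Y / real p)"
        then obtain j where j: "k = p * j" "j \<in> S (insert p P) (Y / real p)" by blast
        have "q \<in> insert p P" if "prime q" "q dvd k" for q
          using that j p by (auto simp: S_def prime_dvd_mult_iff primes_dvd_imp_eq)
        then show ?thesis using j p by (auto simp: S_def field_simps)
      qed (auto simp: S_def)
    qed
    have disj: "S P Y \<inter> (\<lambda>k. p * k) ` S (insert p P) (Y / real p) = {}"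
      using insert.hyps p by (auto simp: S_def)
    have inj: "inj_on (\<lambda>k. p * k) (S (insert p P) (Y / real p))"
      using p by (auto simp: inj_on_def)
    show ?thesis
      unfolding H_def eq using finS disj
      by (subst sum.union_disjoint) (auto simp: sum.reindex[OF inj] sum_distrib_left)
  qed
  \<comment> \<open>Stripping p keeps the set of primes but lowers Y to Y/p \<le> Y/2, so the
    descent runs over an integer n above Y.\<close>
  have "H (insert p P) Y \<le> subset_sum P a Y + a p * subset_sum P a (Y / real p)" if "Y < real n" for n Y
    using that
  proof (induction n arbitrary: Y)
    case 0
    then have "S (insert p P) Y = {}" by (auto simp: S_def)
    then have "H (insert p P) Y = 0" by (simp add: H_def)
    then show ?case using a_nonneg subset_sum_nonneg[of P a] by simp
  next
    case (Suc n)
    show ?case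
    proof (cases "Y < 1")
      case True
      then have "S (insert p P) Y = {}" by (auto simp: S_def)
      then have "H (insert p P) Y = 0" by (simp add: H_def)
      then show ?thesis using a_nonneg subset_sum_nonneg[of P a] by simp
    next
      case False
      have "1 \<le> n" using False Suc.prems by (cases n) auto
      then have "1 \<le> real n" by simp
      moreover have "Y / real p \<le> Y / 2" using p False by (intro divide_left_mono) auto
      ultimately have "Y / real p < real n" using Suc.prems by (simp only: of_nat_Suc)
      from Suc.IH[OF this]
      have "H (insert p P) (Y / real p) \<le> subset_sum P a (Y / real p) + a p * subset_sum P a (Y / real p / real p)" .
      also have "\<dots> \<le> subset_sum P a (Y / real p) + a p * subset_sum P a (Y / real p)"
      proof (intro add_left_mono mult_left_mono subset_sum_mono insert.hyps a_nonneg)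
        show "Y / real p / real p \<le> Y / real p"
          using p False divide_left_mono[of 1 "real p" "Y / real p"] by simp
      qed auto
      also have "\<dots> = (1 + a p) * subset_sum P a (Y / real p)" by (simp add: algebra_simps)
      finally have "1 / real p * H (insert p P) (Y / real p) \<le> 1 / real p * ((1 + a p) * subset_sum P a (Y / real p))"
        by (intro mult_left_mono) auto
      \<comment> \<open>The recursion closes because (1 + a p)/p = a p when a p = 1/(p - 1).\<close>
      also have "\<dots> = a p * subset_sum P a (Y / real p)" using p by (simp add: a_def field_simps)
      finally show ?thesis unfolding rec[of Y] using IH[of Y] by simp
    qed
  qed
  moreover obtain n where "Y < real n" using reals_Archimedean2 by blast
  ultimately have "H (insert p P) Y \<le> subset_sum P a Y + a p * subset_sum P a (Y / real p)" by blast
  also have "\<dots> = subset_sum (insert p P) a Y"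
    using insert.hyps p by (subst subset_sum_insert) auto
  finally show ?case unfolding H_def S_def a_def .
qed

lemma ln_le_subset_sum:
  assumes "0 < m"
  shows "ln (real m + 1) \<le> subset_sum {p. prime p \<and> p \<le> m} (\<lambda>p. 1 / (real p - 1)) (real m)"
proof -
  have "{k. 0 < k \<and> real k \<le> real m \<and> (\<forall>q. prime q \<longrightarrow> q dvd k \<longrightarrow> q \<in> {p. prime p \<and> p \<le> m})} = {1..m}"
    (is "?S = _") by (auto dest: dvd_imp_le)
  moreover have "(\<Sum>k\<in>?S. 1 / real k)
      \<le> subset_sum {p. prime p \<and> p \<le> m} (\<lambda>p. 1 / (real p - 1)) (real m)"
    by (rule harmonic_smooth_le_subset_sum) auto
  ultimately show ?thesis using harmonic_ge_ln[OF assms] by (simp only:)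
qed

text \<open>At level m^3 the sum dominates a product of three one-dimensional sums of level m: one
  over all primes of P, two over those outside B. Each of the latter loses at most the local product
  over B, whence the square. At a good prime the three factors give (p/(p - 1))^3 \<le> p/(p - 3) =
  1 + 3/(p - 3), the local factor of a sieve by three classes; at a bad prime only the first factor
  contributes.\<close>

lemma subset_sum_dim3_ge:
  fixes h :: "nat \<Rightarrow> real"
  assumes m: "0 < m" and P: "P = {p. prime p \<and> p \<le> m}"
    and bad: "\<And>p. p \<in> P \<Longrightarrow> p \<in> B \<Longrightarrow> 1 / (real p - 1) \<le> h p"
    and good: "\<And>p. p \<in> P \<Longrightarrow> p \<notin> B \<Longrightarrow> 3 < p \<and> 3 / (real p - 3) \<le> h p"
  shows "ln (real m + 1) ^ 3 / (\<Prod>p\<in>P \<inter> B. 1 + 1 / (real p - 1)) ^ 2 \<le> subset_sum P h (real m ^ 3)"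
proof -
  define a where "a = (\<lambda>p. 1 / (real p - 1))"
  define b where "b = (\<lambda>p. if p \<in> B then 0 else a p)"
  define c where "c = (\<lambda>p. a p + b p + a p * b p)"
  define W where "W = (\<Prod>p\<in>P \<inter> B. 1 + a p)"
  let ?L = "ln (real m + 1)" and ?Y = "real m"
  have fin: "finite P" by (simp add: P)
  have p2: "2 \<le> real p" if "p \<in> P" for p using that prime_ge_2_nat by (auto simp: P)
  have an: "0 \<le> a p" if "p \<in> P" for p using p2[OF that] by (simp add: a_def)
  have bn: "0 \<le> b p" if "p \<in> P" for p using an[OF that] by (simp add: b_def)
  have cn: "0 \<le> c p" if "p \<in> P" for p using an[OF that] bn[OF that] by (simp add: c_def)
  have pos: "0 < p" if "p \<in> P" for p using p2[OF that] by auto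
  have W1: "1 \<le> W" unfolding W_def using an by (intro prod_ge_1) auto
  have L0: "0 \<le> ?L" by simp
  have La: "?L \<le> subset_sum P a ?Y" unfolding P a_def by (rule ln_le_subset_sum[OF m])
  also have "\<dots> \<le> W * subset_sum P b ?Y"
    unfolding W_def b_def using fin pos an by (intro subset_sum_drop_primes) auto
  finally have Lb: "?L / W \<le> subset_sum P b ?Y" using W1 by (simp add: field_simps)
  have "?L ^ 3 / W ^ 2 = ?L * (?L / W) * (?L / W)" by (simp add: eval_nat_numeral)
  also have "\<dots> \<le> subset_sum P a ?Y * subset_sum P b ?Y * subset_sum P b ?Y"
    using La Lb L0 W1 subset_sum_nonneg[of P a, OF an] subset_sum_nonneg[of P b, OF bn]
    by (intro mult_mono) auto
  also have "\<dots> \<le> subset_sum P c (?Y * ?Y) * subset_sum P b ?Y"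
    unfolding c_def using fin pos an bn subset_sum_nonneg[of P b, OF bn]
    by (intro mult_right_mono subset_sum_mult_le) auto
  also have "\<dots> \<le> subset_sum P (\<lambda>p. c p + b p + c p * b p) (?Y * ?Y * ?Y)"
    using fin pos cn bn by (intro subset_sum_mult_le) auto
  also have "\<dots> \<le> subset_sum P h (?Y * ?Y * ?Y)"
  proof (rule subset_sum_mono_weight)
    fix p assume p: "p \<in> P"
    show "0 \<le> c p + b p + c p * b p" using bn[OF p] cn[OF p] by simp
    show "c p + b p + c p * b p \<le> h p"
    proof (cases "p \<in> B")
      case True
      then show ?thesis using bad[OF p] by (simp add: c_def b_def a_def)
    next
      case False
      have q: "real p > 3" using good[OF p False] by simp
      have "c p + b p + c p * b p = (1 + a p) ^ 3 - 1"
        using False by (simp add: c_def b_def algebra_simps power3_eq_cube)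
      also have "1 + a p = real p / (real p - 1)" using q by (simp add: a_def field_simps)
      also have "(real p / (real p - 1)) ^ 3 - 1 \<le> 3 / (real p - 3)"
      proof -
        have "real p ^ 3 * (real p - 3) \<le> real p * (real p - 1) ^ 3"
          using q by (simp add: algebra_simps power3_eq_cube)
        then have "(real p / (real p - 1)) ^ 3 \<le> real p / (real p - 3)"
          using q by (simp add: power_divide field_simps)
        also have "\<dots> = 1 + 3 / (real p - 3)" using q by (simp add: field_simps)
        finally show ?thesis by simp
      qed
      finally show ?thesis using good[OF p False] by simp
    qed
  qed
  finally show ?thesis by (simp add: W_def a_def power3_eq_cube)
qed

lemma card_primes_le_sieve:
  assumes m: "0 < m"
  shows "real (card {p. prime p \<and> p < N}) \<le> real N / ln (real m + 1) + real m ^ 6 + real m"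
proof -
  let ?P = "{p. prime p \<and> p \<le> m}"
  let ?A = "{t \<in> {..<N}. \<forall>p\<in>?P. t mod p \<notin> {0}}"
  have "{p. prime p \<and> p < N} \<subseteq> ?A \<union> {1..m}"
  proof
    fix q assume q: "q \<in> {p. prime p \<and> p < N}"
    show "q \<in> ?A \<union> {1..m}"
    proof (cases "q \<le> m")
      case False
      have "q mod p \<noteq> 0" if "p \<in> ?P" for p
        using that False q primes_dvd_imp_eq[of p q] by (auto simp: mod_eq_0_iff_dvd)
      then show ?thesis using q by auto
    qed (use q prime_ge_1_nat in auto)
  qed
  then have "card {p. prime p \<and> p < N} \<le> card (?A \<union> {1..m})" by (intro card_mono) auto
  also have "\<dots> \<le> card ?A + m" using card_Un_le[of ?A "{1..m}"] by simp
  finally have 1: "real (card {p. prime p \<and> p < N}) \<le> real (card ?A) + real m"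
    by (simp flip: of_nat_add)
  have "real (card ?A) \<le> real N / subset_sum ?P (\<lambda>p. real (card {0::nat}) / (real p - real (card {0::nat}))) (real m) + real m ^ 6"
    using m by (intro selberg_sieve) (auto dest: prime_gt_1_nat prime_gt_0_nat)
  also have "\<dots> \<le> real N / ln (real m + 1) + real m ^ 6"
  proof -
    have "0 < ln (real m + 1)" using m by simp
    moreover from this have "0 < subset_sum ?P (\<lambda>p. 1 / (real p - 1)) (real m)"
      using ln_le_subset_sum[OF m] by (rule less_le_trans)
    ultimately show ?thesis
      using ln_le_subset_sum[OF m] by (intro add_right_mono divide_left_mono mult_pos_pos) simp_all
  qed
  finally show ?thesis using 1 by simp
qed

section \<open>Three linear forms\<close>

lemma linear_root_mod_prime:
  fixes a b :: int
  assumes "prime p" "\<not> int p dvd a"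
  shows "\<exists>c<p. \<forall>d<p. int p dvd a * int d + b \<longleftrightarrow> d = c"
proof -
  have pp: "prime (int p)" using assms(1) by simp
  then have "coprime a (int p)" using assms(2) prime_imp_coprime coprime_commute by blast
  then obtain x where x: "[a * x = - b] (mod int p)"
    using cong_solve_coprime_int[of a "int p"] by (metis cong_scalar_right mult.assoc mult_1)
  have p0: "int p > 0" using assms(1) prime_gt_0_nat by simp
  define c where "c = nat (x mod int p)"
  have c: "int c = x mod int p" "c < p" using p0 by (auto simp: c_def nat_less_iff)
  have "[a * int c = a * x] (mod int p)" unfolding c by (intro cong_mult cong_refl) (simp add: Cong.cong_def)
  then have "[a * int c = - b] (mod int p)" using x cong_trans by blast
  then have ac: "int p dvd a * int c + b" by (simp add: cong_iff_dvd_diff)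
  have "d = c" if d: "d < p" "int p dvd a * int d + b" for d
  proof -
    have "int p dvd (a * int d + b) - (a * int c + b)" using d(2) ac by (rule dvd_diff)
    then have "int p dvd a * (int d - int c)" by (simp add: algebra_simps)
    then have "int p dvd int d - int c" using pp assms(2) by (simp add: prime_dvd_mult_iff)
    then have "[int d = int c] (mod int p)" by (simp add: cong_iff_dvd_diff)
    then have "[d = c] (mod p)" by (simp add: cong_int_iff)
    then show ?thesis using d c by (simp add: Cong.cong_def)
  qed
  then show ?thesis using ac c(2) by blast
qed

text \<open>In the parametrisation the three forms are q, r and \<plusminus>p as functions of one
  parameter t: with (\<alpha>, \<beta>, \<gamma>, t) = (v, w, z, u) the values are q, r, p, and with
  (u, z, w, v) they are q, r, -p.\<close>

definition form1 :: "int \<Rightarrow> int \<Rightarrow> int \<Rightarrow> int \<Rightarrow> int" where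
  "form1 \<alpha> \<beta> \<gamma> t = \<alpha> * t - \<beta> * \<gamma>"

definition form2 :: "int \<Rightarrow> int \<Rightarrow> int \<Rightarrow> int \<Rightarrow> int" where
  "form2 \<alpha> \<beta> \<gamma> t = \<beta> * t + \<alpha> * \<gamma>"

definition form3 :: "int \<Rightarrow> int \<Rightarrow> int \<Rightarrow> int \<Rightarrow> int" where
  "form3 \<alpha> \<beta> \<gamma> t = \<beta> * t - \<alpha> * \<gamma>"

definition forms_prod :: "int \<Rightarrow> int \<Rightarrow> int \<Rightarrow> int \<Rightarrow> int" where
  "forms_prod \<alpha> \<beta> \<gamma> t = form1 \<alpha> \<beta> \<gamma> t * form2 \<alpha> \<beta> \<gamma> t * form3 \<alpha> \<beta> \<gamma> t"

text \<open>Its prime divisors are those of the leading coefficients and of the three pairwise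
  resultants, which up to sign are \<gamma> (\<alpha>^2 + \<beta>^2), \<gamma> (\<alpha>^2 -
  \<beta>^2) and 2 \<alpha> \<beta> \<gamma>. Modulo any other prime the three forms have three
  distinct roots.\<close>

definition forms_disc :: "int \<Rightarrow> int \<Rightarrow> int \<Rightarrow> int" where
  "forms_disc \<alpha> \<beta> \<gamma> = 2 * \<alpha> * \<beta> * \<gamma> * (\<alpha>\<^sup>2 - \<beta>\<^sup>2) * (\<alpha>\<^sup>2 + \<beta>\<^sup>2)"

lemma prime_dvd_forms_prod:
  assumes "prime p"
  shows "int p dvd forms_prod \<alpha> \<beta> \<gamma> t \<longleftrightarrow>
    int p dvd form1 \<alpha> \<beta> \<gamma> t \<or> int p dvd form2 \<alpha> \<beta> \<gamma> t \<or> int p dvd form3 \<alpha> \<beta> \<gamma> t"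
  using assms by (auto simp: forms_prod_def prime_dvd_mult_iff)

lemma forms_prod_mod:
  "int p dvd forms_prod \<alpha> \<beta> \<gamma> (int (t mod p)) \<longleftrightarrow> int p dvd forms_prod \<alpha> \<beta> \<gamma> (int t)"
proof -
  have "[int (t mod p) = int t] (mod int p)" by (simp add: Cong.cong_def zmod_int)
  then have "[forms_prod \<alpha> \<beta> \<gamma> (int (t mod p)) = forms_prod \<alpha> \<beta> \<gamma> (int t)] (mod int p)"
    unfolding forms_prod_def form1_def form2_def form3_def
    by (intro cong_mult cong_add cong_diff cong_refl)
  then show ?thesis by (rule cong_dvd_iff)
qed

lemma card_forms_roots:
  assumes p: "prime p" and good: "\<not> int p dvd forms_disc \<alpha> \<beta> \<gamma>"
  shows "card {c. c < p \<and> int p dvd forms_prod \<alpha> \<beta> \<gamma> (int c)} = 3"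
proof -
  have pp: "prime (int p)" using p by simp
  have nd: "\<not> int p dvd \<alpha>" "\<not> int p dvd \<beta>" "\<not> int p dvd 2 * \<alpha> * \<gamma>"
    "\<not> int p dvd \<gamma> * (\<alpha>\<^sup>2 - \<beta>\<^sup>2)" "\<not> int p dvd \<gamma> * (\<alpha>\<^sup>2 + \<beta>\<^sup>2)"
    using good pp by (auto simp: forms_disc_def prime_dvd_mult_iff)
  obtain c1 where c1: "c1 < p" "\<And>d. d < p \<Longrightarrow> int p dvd form1 \<alpha> \<beta> \<gamma> (int d) \<longleftrightarrow> d = c1"
    using linear_root_mod_prime[OF p nd(1), of "- \<beta> * \<gamma>"] by (auto simp: form1_def)
  obtain c2 where c2: "c2 < p" "\<And>d. d < p \<Longrightarrow> int p dvd form2 \<alpha> \<beta> \<gamma> (int d) \<longleftrightarrow> d = c2"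
    using linear_root_mod_prime[OF p nd(2), of "\<alpha> * \<gamma>"] by (auto simp: form2_def)
  obtain c3 where c3: "c3 < p" "\<And>d. d < p \<Longrightarrow> int p dvd form3 \<alpha> \<beta> \<gamma> (int d) \<longleftrightarrow> d = c3"
    using linear_root_mod_prime[OF p nd(2), of "- \<alpha> * \<gamma>"] by (auto simp: form3_def)
  have "c1 \<noteq> c2"
  proof
    assume "c1 = c2"
    then have "int p dvd \<alpha> * form2 \<alpha> \<beta> \<gamma> (int c1) - \<beta> * form1 \<alpha> \<beta> \<gamma> (int c1)"
      using c1 c2 by (intro dvd_diff dvd_mult) auto
    also have "\<alpha> * form2 \<alpha> \<beta> \<gamma> (int c1) - \<beta> * form1 \<alpha> \<beta> \<gamma> (int c1) = \<gamma> * (\<alpha>\<^sup>2 + \<beta>\<^sup>2)"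
      by (simp add: form1_def form2_def algebra_simps power2_eq_square)
    finally show False using nd by simp
  qed
  moreover have "c1 \<noteq> c3"
  proof
    assume "c1 = c3"
    then have "int p dvd \<beta> * form1 \<alpha> \<beta> \<gamma> (int c1) - \<alpha> * form3 \<alpha> \<beta> \<gamma> (int c1)"
      using c1 c3 by (intro dvd_diff dvd_mult) auto
    also have "\<beta> * form1 \<alpha> \<beta> \<gamma> (int c1) - \<alpha> * form3 \<alpha> \<beta> \<gamma> (int c1) = \<gamma> * (\<alpha>\<^sup>2 - \<beta>\<^sup>2)"
      by (simp add: form1_def form3_def algebra_simps power2_eq_square)
    finally show False using nd by simp
  qed
  moreover have "c2 \<noteq> c3"
  proof
    assume "c2 = c3"
    then have "int p dvd form2 \<alpha> \<beta> \<gamma> (int c2) - form3 \<alpha> \<beta> \<gamma> (int c2)"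
      using c2 c3 by (intro dvd_diff) auto
    also have "form2 \<alpha> \<beta> \<gamma> (int c2) - form3 \<alpha> \<beta> \<gamma> (int c2) = 2 * \<alpha> * \<gamma>"
      by (simp add: form2_def form3_def)
    finally show False using nd by simp
  qed
  moreover have "{c. c < p \<and> int p dvd forms_prod \<alpha> \<beta> \<gamma> (int c)} = {c1, c2, c3}"
    using c1 c2 c3 by (auto simp: prime_dvd_forms_prod[OF p])
  ultimately show ?thesis by simp
qed

text \<open>By coprimality p fails to divide \<alpha> or \<beta>, so the first or the second form is
  nonconstant modulo p. Thus even a bad prime has a class to remove.\<close>

lemma forms_root_exists:
  assumes p: "prime p" and cop: "coprime \<alpha> \<beta>"
  shows "\<exists>c<p. int p dvd forms_prod \<alpha> \<beta> \<gamma> (int c)"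
proof (cases "int p dvd \<alpha>")
  case True
  have "\<not> int p dvd \<beta>"
  proof
    assume "int p dvd \<beta>"
    then have "is_unit (int p)" by (rule coprime_common_divisor[OF cop True])
    then show False using p by (simp add: prime_nat_iff)
  qed
  from linear_root_mod_prime[OF p this, of "\<alpha> * \<gamma>"] show ?thesis
    by (auto simp: prime_dvd_forms_prod[OF p] form2_def)
next
  case False
  from linear_root_mod_prime[OF p this, of "- \<beta> * \<gamma>"] show ?thesis
    by (auto simp: prime_dvd_forms_prod[OF p] form1_def)
qed

section \<open>Simultaneous prime values of the three forms\<close>

text \<open>Controls the exceptions to the sieve: a form may be divisible by a sifting prime p \<le>
  m and still be prime if its absolute value is p.\<close>

lemma card_small_linear_values:
  fixes a b :: int
  assumes "a \<noteq> 0"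
  shows "card {t \<in> {..<N}. \<bar>a * int t + b\<bar> \<le> int m} \<le> 2 * m + 1"
proof -
  have "card {t \<in> {..<N}. \<bar>a * int t + b\<bar> \<le> int m} \<le> card {- int m..int m}"
    using assms by (intro card_inj_on_le[of "\<lambda>t. a * int t + b"]) (auto simp: inj_on_def)
  then show ?thesis by simp
qed

text \<open>Absolute values are taken because the third form may equal -p. The last condition
  expresses p \<noteq> r and is what forces \<alpha> and \<beta> to be coprime: a nontrivial common
  divisor would divide two primes and so be equal to both.\<close>

definition prime_triple :: "int \<Rightarrow> int \<Rightarrow> int \<Rightarrow> nat \<Rightarrow> bool" where
  "prime_triple \<alpha> \<beta> \<gamma> t \<longleftrightarrow> prime \<bar>form1 \<alpha> \<beta> \<gamma> (int t)\<bar> \<and> prime \<bar>form2 \<alpha> \<beta> \<gamma> (int t)\<bar> \<and>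
     prime \<bar>form3 \<alpha> \<beta> \<gamma> (int t)\<bar> \<and> \<bar>form2 \<alpha> \<beta> \<gamma> (int t)\<bar> \<noteq> \<bar>form3 \<alpha> \<beta> \<gamma> (int t)\<bar>"

lemma prime_triple_imp_coprime:
  assumes "prime_triple \<alpha> \<beta> \<gamma> t"
  shows "coprime \<alpha> \<beta>"
proof (rule ccontr)
  assume "\<not> coprime \<alpha> \<beta>"
  then obtain d where d: "d dvd \<alpha>" "d dvd \<beta>" "\<not> is_unit d" by (rule not_coprimeE)
  then have "d dvd form2 \<alpha> \<beta> \<gamma> (int t)" "d dvd form3 \<alpha> \<beta> \<gamma> (int t)"
    by (auto simp: form2_def form3_def)
  then have "\<bar>d\<bar> dvd \<bar>form2 \<alpha> \<beta> \<gamma> (int t)\<bar>" "\<bar>d\<bar> dvd \<bar>form3 \<alpha> \<beta> \<gamma> (int t)\<bar>" by auto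
  moreover have "prime \<bar>form2 \<alpha> \<beta> \<gamma> (int t)\<bar>" "prime \<bar>form3 \<alpha> \<beta> \<gamma> (int t)\<bar>"
    using assms by (auto simp: prime_triple_def)
  moreover have "\<bar>d\<bar> = z" if "\<bar>d\<bar> dvd z" "prime z" for z
    using that d(3) by (auto simp: prime_int_iff dest!: spec[of _ "\<bar>d\<bar>"])
  ultimately have "\<bar>d\<bar> = \<bar>form2 \<alpha> \<beta> \<gamma> (int t)\<bar>" "\<bar>d\<bar> = \<bar>form3 \<alpha> \<beta> \<gamma> (int t)\<bar>" by blast+
  then show False using assms by (simp add: prime_triple_def)
qed

lemma card_prime_triple_sieve:
  fixes \<alpha> \<beta> \<gamma> :: int and y m N :: nat
  assumes nz: "\<alpha> \<noteq> 0" "\<beta> \<noteq> 0" and y: "3 \<le> y" and m: "0 < m"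
  defines "W \<equiv> (\<Prod>p | prime p \<and> p \<le> m \<and> (p \<le> y \<or> int p dvd forms_disc \<alpha> \<beta> \<gamma>). 1 + 1 / (real p - 1))"
  shows "real (card {t \<in> {..<N}. prime_triple \<alpha> \<beta> \<gamma> t})
    \<le> real N * W\<^sup>2 / ln (real m + 1) ^ 3 + real m ^ 18 + 9 * real m"
proof (cases "\<exists>t. prime_triple \<alpha> \<beta> \<gamma> t")
  case False
  have "0 \<le> W\<^sup>2" "0 \<le> ln (real m + 1)" by simp_all
  then show ?thesis using False by simp
next
  case True
  \<comment> \<open>Coprimality comes from a single existing triple; if there is none, the count is
    0.\<close>
  then have cop: "coprime \<alpha> \<beta>" using prime_triple_imp_coprime by blast
  define P where "P = {p. prime p \<and> p \<le> m}"
  define B where "B = {p::nat. p \<le> y \<or> int p dvd forms_disc \<alpha> \<beta> \<gamma>}"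
  define R where "R = (\<lambda>p. {c. c < p \<and> int p dvd forms_prod \<alpha> \<beta> \<gamma> (int c)})"
  \<comment> \<open>All three roots are removed at a good prime, one chosen root at a bad prime.
    Since B contains the primes up to y \<ge> 3, good primes exceed 3 and not all of their classes
    are removed.\<close>
  define \<Omega> where "\<Omega> = (\<lambda>p. if p \<in> B then {SOME c. c \<in> R p} else R p)"
  have \<Omega>R: "\<Omega> p \<subseteq> R p" if "p \<in> P" for p
  proof -
    have "\<exists>c. c \<in> R p" using forms_root_exists[OF _ cop] that unfolding P_def R_def by auto
    then have "(SOME c. c \<in> R p) \<in> R p" by (rule someI_ex)
    then show ?thesis by (simp add: \<Omega>_def)
  qed
  have card_good: "card (\<Omega> p) = 3 \<and> 3 < p" if "p \<in> P" "p \<notin> B" for p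
    using that card_forms_roots[of p] y unfolding \<Omega>_def R_def P_def B_def by auto
  have card_bad: "card (\<Omega> p) = 1" if "p \<in> B" for p using that by (simp add: \<Omega>_def)
  let ?A = "{t \<in> {..<N}. \<forall>p\<in>P. t mod p \<notin> \<Omega> p}"
  let ?E1 = "{t \<in> {..<N}. \<bar>\<alpha> * int t + - \<beta> * \<gamma>\<bar> \<le> int m}"
  let ?E2 = "{t \<in> {..<N}. \<bar>\<beta> * int t + \<alpha> * \<gamma>\<bar> \<le> int m}"
  let ?E3 = "{t \<in> {..<N}. \<bar>\<beta> * int t + - \<alpha> * \<gamma>\<bar> \<le> int m}"
  have "{t \<in> {..<N}. prime_triple \<alpha> \<beta> \<gamma> t} \<subseteq> ?A \<union> (?E1 \<union> (?E2 \<union> ?E3))"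
  proof
    fix t assume t: "t \<in> {t \<in> {..<N}. prime_triple \<alpha> \<beta> \<gamma> t}"
    show "t \<in> ?A \<union> (?E1 \<union> (?E2 \<union> ?E3))"
    proof (rule ccontr)
      assume *: "t \<notin> ?A \<union> (?E1 \<union> (?E2 \<union> ?E3))"
      then obtain p where p: "p \<in> P" "t mod p \<in> \<Omega> p" using t by auto
      then have pr: "prime p" "p \<le> m" by (auto simp: P_def)
      have "int p dvd forms_prod \<alpha> \<beta> \<gamma> (int (t mod p))" using p \<Omega>R by (auto simp: R_def)
      then have dv: "int p dvd form1 \<alpha> \<beta> \<gamma> (int t) \<or> int p dvd form2 \<alpha> \<beta> \<gamma> (int t) \<or> int p dvd form3 \<alpha> \<beta> \<gamma> (int t)"
        unfolding forms_prod_mod prime_dvd_forms_prod[OF pr(1)] .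
      have key: "\<not> int p dvd z" if "prime \<bar>z\<bar>" "int m < \<bar>z\<bar>" for z :: int
      proof
        assume "int p dvd z"
        then have "int p dvd \<bar>z\<bar>" by simp
        then have "int p = \<bar>z\<bar>" using that(1) pr(1) by (intro primes_dvd_imp_eq) auto
        then show False using that(2) pr(2) by simp
      qed
      have "int m < \<bar>form1 \<alpha> \<beta> \<gamma> (int t)\<bar>" "int m < \<bar>form2 \<alpha> \<beta> \<gamma> (int t)\<bar>" "int m < \<bar>form3 \<alpha> \<beta> \<gamma> (int t)\<bar>"
        using t * unfolding form1_def form2_def form3_def by auto
      moreover have "prime \<bar>form1 \<alpha> \<beta> \<gamma> (int t)\<bar>" "prime \<bar>form2 \<alpha> \<beta> \<gamma> (int t)\<bar>" "prime \<bar>form3 \<alpha> \<beta> \<gamma> (int t)\<bar>"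
        using t by (simp_all add: prime_triple_def)
      ultimately show False using dv key by metis
    qed
  qed
  then have "card {t \<in> {..<N}. prime_triple \<alpha> \<beta> \<gamma> t} \<le> card (?A \<union> (?E1 \<union> (?E2 \<union> ?E3)))"
    by (intro card_mono) auto
  also have "\<dots> \<le> card ?A + (card ?E1 + (card ?E2 + card ?E3))"
    using card_Un_le[of ?A "?E1 \<union> (?E2 \<union> ?E3)"] card_Un_le[of ?E1 "?E2 \<union> ?E3"] card_Un_le[of ?E2 ?E3]
    by linarith
  also have "\<dots> \<le> card ?A + ((2 * m + 1) + ((2 * m + 1) + (2 * m + 1)))"
    using nz by (intro add_mono order_refl card_small_linear_values)
  also have "\<dots> \<le> card ?A + 9 * m" using m by simp
  finally have "real (card {t \<in> {..<N}. prime_triple \<alpha> \<beta> \<gamma> t}) \<le> real (card ?A + 9 * m)"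
    by (rule of_nat_mono)
  then have 1: "real (card {t \<in> {..<N}. prime_triple \<alpha> \<beta> \<gamma> t}) \<le> real (card ?A) + 9 * real m"
    by (simp only: of_nat_add of_nat_mult of_nat_numeral)
  let ?h = "\<lambda>p. real (card (\<Omega> p)) / (real p - real (card (\<Omega> p)))"
  let ?J = "subset_sum P ?h (real m ^ 3)"
  \<comment> \<open>The level m^3 is that of the product of three sums of level m; its sixth power
    is the remainder m^18.\<close>
  have "real (card ?A) \<le> real N / ?J + (real m ^ 3) ^ 6"
  proof (rule selberg_sieve)
    show "finite P" by (simp add: P_def)
    show "prime p" if "p \<in> P" for p using that by (simp add: P_def)
    show "\<Omega> p \<subseteq> {..<p}" if "p \<in> P" for p using \<Omega>R[OF that] by (auto simp: R_def)
    show "0 < card (\<Omega> p)" if "p \<in> P" for p using card_good[OF that] card_bad[of p] by (cases "p \<in> B") auto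
    show "card (\<Omega> p) < p" if "p \<in> P" for p
      using card_good[OF that] card_bad[of p] that prime_gt_1_nat[of p] by (cases "p \<in> B") (auto simp: P_def)
    show "1 \<le> real m ^ 3" using m by simp
  qed
  also have "real N / ?J \<le> real N / (ln (real m + 1) ^ 3 / W\<^sup>2)"
  proof (rule divide_left_mono)
    have W: "W = (\<Prod>p\<in>P \<inter> B. 1 + 1 / (real p - 1))"
      unfolding W_def P_def B_def by (intro prod.cong) auto
    show le: "ln (real m + 1) ^ 3 / W\<^sup>2 \<le> ?J"
      unfolding W
    proof (rule subset_sum_dim3_ge[OF m])
      show "P = {p. prime p \<and> p \<le> m}" by (simp add: P_def)
    qed (use card_bad card_good in auto)
    have "0 < W" unfolding W P_def by (intro prod_pos) (auto dest!: prime_gt_1_nat simp: add_pos_pos)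
    then have "0 < ln (real m + 1) ^ 3 / W\<^sup>2" using m by (intro divide_pos_pos zero_less_power) auto
    then show "0 < ?J * (ln (real m + 1) ^ 3 / W\<^sup>2)" using le by (intro mult_pos_pos) auto
  qed simp
  finally show ?thesis using 1 by (simp flip: power_mult)
qed

text \<open>Primes up to y are handled by Mertens. The larger prime divisors of M number at most
  log2 |M|, since their product divides M and each is at least 2, and each contributes a factor of
  at most exp(1/y).\<close>

lemma prod_bad_primes_le:
  fixes M :: int and m y :: nat
  assumes M: "M \<noteq> 0" and y: "2 \<le> y"
  shows "(\<Prod>p | prime p \<and> p \<le> m \<and> (p \<le> y \<or> int p dvd M). 1 + 1 / (real p - 1))
    \<le> exp 4 * (1 + ln (real y)) * exp (log 2 (real_of_int \<bar>M\<bar>) / real y)"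
proof -
  let ?f = "\<lambda>p::nat. 1 + 1 / (real p - 1)"
  let ?Y = "{p. prime p \<and> p \<le> y}"
  define Q where "Q = {p. prime p \<and> y < p \<and> int p dvd M}"
  have f1: "1 \<le> ?f p" if "prime p" for p using prime_gt_1_nat[OF that] by simp
  have Qdvd: "p dvd nat \<bar>M\<bar>" if "p \<in> Q" for p using that by (simp add: Q_def dvd_nat_abs_iff)
  have "p \<le> nat \<bar>M\<bar>" if "p \<in> Q" for p using Qdvd[OF that] M by (intro dvd_imp_le) auto
  then have "Q \<subseteq> {..nat \<bar>M\<bar>}" by auto
  then have finQ: "finite Q" using finite_subset by blast
  have "\<Prod>Q dvd nat \<bar>M\<bar>"
    using finQ Qdvd by (intro prod_pairwise_coprime_dvd) (auto simp: Q_def intro: primes_coprime)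
  then have "\<Prod>Q \<le> nat \<bar>M\<bar>" using M by (intro dvd_imp_le) auto
  moreover have "(\<Prod>p\<in>Q. 2) \<le> \<Prod>Q" by (intro prod_mono) (auto simp: Q_def dest: prime_ge_2_nat)
  ultimately have "2 ^ card Q \<le> nat \<bar>M\<bar>" by (simp only: prod_constant order_trans)
  then have "real (2 ^ card Q) \<le> real (nat \<bar>M\<bar>)" by (rule of_nat_mono)
  then have "2 powr real (card Q) \<le> real_of_int \<bar>M\<bar>" by (simp add: powr_realpow)
  then have cardQ: "real (card Q) \<le> log 2 (real_of_int \<bar>M\<bar>)" using M by (simp add: le_log_iff)
  have "(\<Prod>p | prime p \<and> p \<le> m \<and> (p \<le> y \<or> int p dvd M). ?f p) \<le> (\<Prod>p\<in>?Y \<union> Q. ?f p)"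
    using finQ f1 by (intro prod_mono2) (auto simp: Q_def intro: order_trans[OF zero_le_one])
  also have "\<dots> = (\<Prod>p\<in>?Y. ?f p) * (\<Prod>p\<in>Q. ?f p)"
    using finQ by (intro prod.union_disjoint) (auto simp: Q_def)
  also have "\<dots> \<le> exp 4 * (1 + ln (real y)) * exp (log 2 (real_of_int \<bar>M\<bar>) / real y)"
  proof (rule mult_mono)
    show "(\<Prod>p\<in>?Y. ?f p) \<le> exp 4 * (1 + ln (real y))" using mertens_product_le[OF y] .
    have "(\<Prod>p\<in>Q. ?f p) \<le> (\<Prod>p\<in>Q. exp (1 / real y))"
    proof (rule prod_mono)
      fix p assume p: "p \<in> Q"
      then have "real y \<le> real p - 1" by (simp add: Q_def)
      then have "1 / (real p - 1) \<le> 1 / real y" using y by (intro divide_left_mono) auto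
      then have "?f p \<le> exp (1 / real y)" using exp_ge_add_one_self[of "1 / real y"] by linarith
      then show "0 \<le> ?f p \<and> ?f p \<le> exp (1 / real y)" using f1[of p] p by (simp add: Q_def)
    qed
    also have "\<dots> = exp (real (card Q) / real y)" by (simp add: exp_of_nat_mult[symmetric])
    also have "\<dots> \<le> exp (log 2 (real_of_int \<bar>M\<bar>) / real y)"
      using cardQ by (simp add: divide_right_mono)
    finally show "(\<Prod>p\<in>Q. ?f p) \<le> exp (log 2 (real_of_int \<bar>M\<bar>) / real y)" .
    show "0 \<le> (\<Prod>p\<in>Q. ?f p)" using f1 by (intro prod_nonneg) (auto simp: Q_def intro: order_trans[OF zero_le_one])
    show "0 \<le> exp 4 * (1 + ln (real y))" using y by simp
  qed
  finally show ?thesis .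
qed

lemma forms_disc_nonzero:
  assumes "\<alpha> \<noteq> 0" "\<beta> \<noteq> 0" "\<gamma> \<noteq> 0" "\<alpha>\<^sup>2 \<noteq> \<beta>\<^sup>2"
  shows "forms_disc \<alpha> \<beta> \<gamma> \<noteq> 0"
proof -
  have "\<alpha>\<^sup>2 + \<beta>\<^sup>2 \<noteq> 0" using assms by (simp add: sum_power2_eq_zero_iff)
  then show ?thesis using assms by (simp add: forms_disc_def)
qed

lemma abs_forms_disc_le:
  assumes "\<bar>\<alpha>\<bar> \<le> X" "\<bar>\<beta>\<bar> \<le> X" "\<bar>\<gamma>\<bar> \<le> X" "2 \<le> X"
  shows "\<bar>forms_disc \<alpha> \<beta> \<gamma>\<bar> \<le> X ^ 9"
proof -
  have sq: "\<alpha>\<^sup>2 \<le> X\<^sup>2" "\<beta>\<^sup>2 \<le> X\<^sup>2" using assms by (auto simp: abs_le_square_iff[symmetric])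
  have d: "\<bar>\<alpha>\<^sup>2 - \<beta>\<^sup>2\<bar> \<le> X\<^sup>2" "\<bar>\<alpha>\<^sup>2 + \<beta>\<^sup>2\<bar> \<le> 2 * X\<^sup>2"
    using sq zero_le_power2[of \<alpha>] zero_le_power2[of \<beta>] by linarith+
  have "\<bar>forms_disc \<alpha> \<beta> \<gamma>\<bar> = 2 * \<bar>\<alpha>\<bar> * \<bar>\<beta>\<bar> * \<bar>\<gamma>\<bar> * \<bar>\<alpha>\<^sup>2 - \<beta>\<^sup>2\<bar> * \<bar>\<alpha>\<^sup>2 + \<beta>\<^sup>2\<bar>"
    by (simp add: forms_disc_def abs_mult)
  also have "\<dots> \<le> 2 * X * X * X * X\<^sup>2 * (2 * X\<^sup>2)"
    using assms d by (intro mult_mono) auto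
  also have "\<dots> = 2 * 2 * X ^ 7" by (simp add: eval_nat_numeral)
  also have "\<dots> \<le> X * X * X ^ 7" using assms by (intro mult_mono) auto
  also have "\<dots> = X ^ 9" by (simp add: eval_nat_numeral)
  finally show ?thesis .
qed

text \<open>The integer part of N^(1/k) serves as m. The lower bound for ln(m + 1), rather than ln
  m, absorbs the rounding and fits the logarithm produced by the sieve density.\<close>

lemma ex_root_nat_floor:
  fixes N k :: nat
  assumes "0 < N" "0 < k"
  obtains m where "0 < m" "m ^ k \<le> N" "ln (real N) / real k \<le> ln (real m + 1)"
proof
  define r where "r = real N powr (1 / real k)"
  have r1: "1 \<le> r" using assms by (simp add: r_def ge_one_powr_ge_zero)
  show "0 < nat \<lfloor>r\<rfloor>" using r1 by simp
  have "real (nat \<lfloor>r\<rfloor>) ^ k \<le> r ^ k" using r1 by (intro power_mono) auto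
  also have "\<dots> = real N" using assms r1 by (simp add: r_def flip: powr_realpow) (simp add: powr_powr)
  finally show "nat \<lfloor>r\<rfloor> ^ k \<le> N" by (simp flip: of_nat_power)
  have "ln (real N) / real k = ln r" using assms by (simp add: r_def ln_powr)
  also have "\<dots> \<le> ln (real (nat \<lfloor>r\<rfloor>) + 1)"
  proof (rule ln_mono)
    show "r \<le> real (nat \<lfloor>r\<rfloor>) + 1" using r1 real_of_int_floor_add_one_ge[of r] by simp
  qed (use r1 in auto)
  finally show "ln (real N) / real k \<le> ln (real (nat \<lfloor>r\<rfloor>) + 1)" .
qed

lemma chebyshev_upper:
  obtains C where "0 < C"
    "eventually (\<lambda>n. real (card {p. prime p \<and> p \<le> n}) \<le> C * (real n / ln (real n))) sequentially"
proof
  have "eventually (\<lambda>n::nat. 2 * sqrt (real n + 1) \<le> real n / ln (real n)) sequentially" by real_asymp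
  then show "eventually (\<lambda>n. real (card {p. prime p \<and> p \<le> n}) \<le> 26 * (real n / ln (real n))) sequentially"
    using eventually_gt_at_top[of 1]
  proof eventually_elim
    case (elim n)
    \<comment> \<open>The exponent 12 makes the remainder m^6 at most the square root of n + 1. The
      main term then has the constant 24 = 2 * 12.\<close>
    obtain m where m: "0 < m" "m ^ 12 \<le> n + 1" "ln (real (n + 1)) / real (12::nat) \<le> ln (real m + 1)"
      using ex_root_nat_floor[of "n + 1" 12] by auto
    have ln0: "0 < ln (real n)" using elim by simp
    have lnm: "ln (real n) / 12 \<le> ln (real m + 1)"
    proof -
      have "ln (real n) \<le> ln (real (n + 1))" using elim by simp
      then show ?thesis using m(3) by simp
    qed
    have "real (m ^ 12) \<le> real (n + 1)" using m(2) by (rule of_nat_mono)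
    then have "(real m ^ 6)\<^sup>2 \<le> real n + 1" by (simp flip: power_mult)
    then have m6: "real m ^ 6 \<le> sqrt (real n + 1)" by (rule real_le_rsqrt)
    have "real m \<le> real m ^ 6" using m(1) power_increasing[of 1 6 "real m"] by simp
    then have m1: "real m \<le> sqrt (real n + 1)" using m6 by (rule order_trans)
    have "{p. prime p \<and> p \<le> n} = {p. prime p \<and> p < n + 1}" by auto
    then have "real (card {p. prime p \<and> p \<le> n}) \<le> real (n + 1) / ln (real m + 1) + real m ^ 6 + real m"
      using card_primes_le_sieve[OF m(1), of "n + 1"] by simp
    also have "\<dots> \<le> real (n + 1) / (ln (real n) / 12) + sqrt (real n + 1) + sqrt (real n + 1)"
      using lnm ln0 m6 m1 m(1) by (intro add_mono divide_left_mono mult_pos_pos) auto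
    also have "real (n + 1) / (ln (real n) / 12) \<le> 2 * real n / (ln (real n) / 12)"
      using ln0 elim by (intro divide_right_mono) auto
    also have "2 * real n / (ln (real n) / 12) = 24 * (real n / ln (real n))" by simp
    finally show ?case using elim by simp
  qed
qed simp

text \<open>The condition X \<le> 4 N^2 puts N above X^(1/2)/2, so that ln N is comparable to ln X;
  the coefficients enter only through the bad primes, which makes the estimate uniform in
  them.\<close>

lemma card_prime_triple_bound:
  obtains C where "0 < C"
    "eventually (\<lambda>X::nat. \<forall>N \<alpha> \<beta> \<gamma>. 0 < N \<longrightarrow> X \<le> 4 * N\<^sup>2 \<longrightarrow>
       \<bar>\<alpha>\<bar> \<le> int X \<longrightarrow> \<bar>\<beta>\<bar> \<le> int X \<longrightarrow> \<bar>\<gamma>\<bar> \<le> int X \<longrightarrow> \<alpha> \<noteq> 0 \<longrightarrow> \<beta> \<noteq> 0 \<longrightarrow> \<gamma> \<noteq> 0 \<longrightarrow> \<alpha>\<^sup>2 \<noteq> \<beta>\<^sup>2 \<longrightarrow>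
       real (card {t \<in> {1..N}. prime_triple \<alpha> \<beta> \<gamma> t}) \<le> C * real N * ((ln (ln (real X)))\<^sup>2 / ln (real X) ^ 3)) sequentially"
proof
  \<comment> \<open>K is 3 exp 4 exp 18, from the product over the bad primes. In C, 144 = 36 * 4
    bounds the ratio of ln X to ln(m + 1), the factor 2 comes from N + 1 \<le> 2 N, and 10 = 1 + 9
    from the two remainder terms.\<close>
  define K :: real where "K = 3 * exp 22"
  define C where "C = 2 * K\<^sup>2 * 144 ^ 3 + 10"
  show "0 < C" unfolding C_def by (intro add_nonneg_pos) auto
  have e1: "eventually (\<lambda>X::nat. ln (real X) ^ 3 \<le> sqrt (sqrt (real X) / 2)) sequentially" by real_asymp
  have e2: "eventually (\<lambda>X::nat. 1 \<le> ln (ln (real X))) sequentially" by real_asymp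
  have e3: "eventually (\<lambda>X::nat. 4 \<le> ln (real X)) sequentially" by real_asymp
  show "eventually (\<lambda>X::nat. \<forall>N \<alpha> \<beta> \<gamma>. 0 < N \<longrightarrow> X \<le> 4 * N\<^sup>2 \<longrightarrow>
       \<bar>\<alpha>\<bar> \<le> int X \<longrightarrow> \<bar>\<beta>\<bar> \<le> int X \<longrightarrow> \<bar>\<gamma>\<bar> \<le> int X \<longrightarrow> \<alpha> \<noteq> 0 \<longrightarrow> \<beta> \<noteq> 0 \<longrightarrow> \<gamma> \<noteq> 0 \<longrightarrow> \<alpha>\<^sup>2 \<noteq> \<beta>\<^sup>2 \<longrightarrow>
       real (card {t \<in> {1..N}. prime_triple \<alpha> \<beta> \<gamma> t}) \<le> C * real N * ((ln (ln (real X)))\<^sup>2 / ln (real X) ^ 3)) sequentially"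
    using e1 e2 e3 eventually_ge_at_top[of 2]
  proof (eventually_elim, intro allI impI)
    fix X N :: nat and \<alpha> \<beta> \<gamma> :: int
    assume E: "ln (real X) ^ 3 \<le> sqrt (sqrt (real X) / 2)" "1 \<le> ln (ln (real X))" "4 \<le> ln (real X)" "2 \<le> X"
      and N: "0 < N" "X \<le> 4 * N\<^sup>2" and le: "\<bar>\<alpha>\<bar> \<le> int X" "\<bar>\<beta>\<bar> \<le> int X" "\<bar>\<gamma>\<bar> \<le> int X"
      and nz: "\<alpha> \<noteq> 0" "\<beta> \<noteq> 0" "\<gamma> \<noteq> 0" "\<alpha>\<^sup>2 \<noteq> \<beta>\<^sup>2"
    define l where "l = ln (real X)"
    define y where "y = nat \<lceil>l\<rceil>"
    have l: "4 \<le> l" "1 \<le> ln l" using E by (auto simp: l_def)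
    have y: "l \<le> real y" "real y \<le> 2 * l" "3 \<le> y"
    proof -
      show "l \<le> real y" unfolding y_def by (rule real_nat_ceiling_ge)
      then show "3 \<le> y" using l by linarith
      have "real y \<le> l + 1" unfolding y_def using l by linarith
      then show "real y \<le> 2 * l" using l by linarith
    qed
    have "real X \<le> real (4 * N\<^sup>2)" using N(2) by (rule of_nat_mono)
    then have X4: "real X \<le> (2 * real N)\<^sup>2" by (simp add: power_mult_distrib)
    then have "sqrt (real X) \<le> 2 * real N" by (intro real_le_lsqrt) auto
    then have sqN: "sqrt (sqrt (real X) / 2) \<le> sqrt (real N)" by simp
    have l3: "l ^ 3 \<le> sqrt (real N)" unfolding l_def using E(1) sqN by (rule order_trans)
    have lN: "l / 4 \<le> ln (real N)"
    proof -
      have "l \<le> ln ((2 * real N)\<^sup>2)" unfolding l_def using X4 E(4) by (intro ln_mono) auto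
      also have "\<dots> = 2 * ln 2 + 2 * ln (real N)" using N by (simp only: ln_realpow) (simp add: ln_mult_pos)
      finally have "l \<le> 2 * ln 2 + 2 * ln (real N)" .
      moreover have "ln 2 \<le> (1::real)" using ln_le_minus_one[of "2::real"] by simp
      ultimately show ?thesis using l by linarith
    qed
    \<comment> \<open>With 36 = 2 * 18 the remainder m^18 is at most the square root of N.\<close>
    obtain m where m: "0 < m" "m ^ 36 \<le> N" "ln (real N) / real (36::nat) \<le> ln (real m + 1)"
      using ex_root_nat_floor[of N 36] N by auto
    have lm: "l / 144 \<le> ln (real m + 1)" using m(3) lN by simp
    have "real (m ^ 36) \<le> real N" using m(2) by (rule of_nat_mono)
    then have "(real m ^ 18)\<^sup>2 \<le> real N" by (simp flip: power_mult)
    then have m18: "real m ^ 18 \<le> sqrt (real N)" by (rule real_le_rsqrt)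
    have "real m \<le> real m ^ 18" using m(1) power_increasing[of 1 18 "real m"] by simp
    then have m1: "real m \<le> sqrt (real N)" using m18 by (rule order_trans)
    \<comment> \<open>The discriminant is at most X^9, so it has at most 9 l / ln 2 \<le> 18 l prime
      divisors; division by y \<ge> l leaves the exponent 18.\<close>
    define M where "M = forms_disc \<alpha> \<beta> \<gamma>"
    have M0: "M \<noteq> 0" unfolding M_def by (rule forms_disc_nonzero[OF nz])
    have "\<bar>M\<bar> \<le> int X ^ 9" unfolding M_def using le E(4) by (intro abs_forms_disc_le) auto
    then have "real_of_int \<bar>M\<bar> \<le> real_of_int (int X ^ 9)" by (rule of_int_le_iff[THEN iffD2])
    then have "ln (real_of_int \<bar>M\<bar>) \<le> ln (real X ^ 9)" using M0 by (intro ln_mono) auto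
    then have "ln (real_of_int \<bar>M\<bar>) \<le> 9 * l" by (simp add: ln_realpow l_def)
    then have "log 2 (real_of_int \<bar>M\<bar>) \<le> 9 * l / ln 2" unfolding log_def by (intro divide_right_mono) auto
    also have "\<dots> \<le> 9 * l / (1 / 2)"
    proof (rule divide_left_mono)
      have "ln (1 / 2) \<le> 1 / 2 - (1::real)" by (rule ln_le_minus_one) simp
      then show "1 / 2 \<le> ln (2::real)" by (simp add: ln_divide_pos)
    qed (use l in auto)
    finally have "log 2 (real_of_int \<bar>M\<bar>) / real y \<le> 18 * l / real y" by (intro divide_right_mono) auto
    also have "\<dots> \<le> 18" using y l by (simp add: field_simps)
    finally have logM: "log 2 (real_of_int \<bar>M\<bar>) / real y \<le> 18" .
    define W where "W = (\<Prod>p | prime p \<and> p \<le> m \<and> (p \<le> y \<or> int p dvd M). 1 + 1 / (real p - 1))"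
    have "W \<le> exp 4 * (1 + ln (real y)) * exp (log 2 (real_of_int \<bar>M\<bar>) / real y)"
      unfolding W_def using M0 y by (intro prod_bad_primes_le) auto
    also have "\<dots> \<le> exp 4 * (3 * ln l) * exp 18"
    proof -
      have "ln (real y) \<le> ln (2 * l)" using y l by (intro ln_mono) auto
      also have "\<dots> = ln 2 + ln l" using l by (simp add: ln_mult_pos)
      finally have "1 + ln (real y) \<le> 3 * ln l" using ln_le_minus_one[of "2::real"] l by simp
      then show ?thesis using logM y by (intro mult_mono) auto
    qed
    also have "\<dots> = K * ln l"
    proof -
      have "exp 4 * exp 18 = exp (22::real)" by (simp flip: exp_add)
      then show ?thesis by (simp add: K_def mult_ac)
    qed
    finally have W: "W \<le> K * ln l" .
    have W0: "0 \<le> W" unfolding W_def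
      by (intro prod_nonneg) (auto dest!: prime_gt_1_nat intro: add_nonneg_nonneg)
    have "real (card {t \<in> {1..N}. prime_triple \<alpha> \<beta> \<gamma> t}) \<le> real (card {t \<in> {..<N + 1}. prime_triple \<alpha> \<beta> \<gamma> t})"
      by (intro of_nat_mono card_mono) auto
    also have "\<dots> \<le> real (N + 1) * W\<^sup>2 / ln (real m + 1) ^ 3 + real m ^ 18 + 9 * real m"
      unfolding W_def M_def using nz y m by (intro card_prime_triple_sieve) auto
    also have "\<dots> \<le> (2 * real N) * (K * ln l)\<^sup>2 / (l / 144) ^ 3 + sqrt (real N) + 9 * sqrt (real N)"
    proof (intro add_mono mult_left_mono frac_le mult_mono power_mono)
      show "real (N + 1) \<le> 2 * real N" using N by simp
    qed (use W W0 lm l m18 m1 in auto)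
    also have "\<dots> = 2 * K\<^sup>2 * 144 ^ 3 * real N * ((ln l)\<^sup>2 / l ^ 3) + 10 * sqrt (real N)"
      by (simp add: power_mult_distrib power_divide)
    also have "sqrt (real N) \<le> real N * ((ln l)\<^sup>2 / l ^ 3)"
    proof -
      have "sqrt (real N) * l ^ 3 \<le> sqrt (real N) * sqrt (real N)" using l3 by (intro mult_left_mono) auto
      then have "sqrt (real N) \<le> real N * (1 / l ^ 3)" using l by (simp add: field_simps)
      also have "\<dots> \<le> real N * ((ln l)\<^sup>2 / l ^ 3)"
        using l by (intro mult_left_mono divide_right_mono) auto
      finally show ?thesis .
    qed
    finally show "real (card {t \<in> {1..N}. prime_triple \<alpha> \<beta> \<gamma> t}) \<le> C * real N * ((ln (ln (real X)))\<^sup>2 / ln (real X) ^ 3)"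
      unfolding C_def l_def by (simp add: algebra_simps)
  qed
qed

section \<open>Two representations as a sum of two squares\<close>

text \<open>Take u = gcd(A, C). The cofactors v and w are coprime, so v B = w D forces w to divide
  B, and z is the quotient.\<close>

lemma four_factors:
  fixes A B C D :: nat
  assumes "A * B = C * D" "0 < A" "0 < B" "0 < C" "0 < D"
  obtains u v w z where "A = u * v" "B = w * z" "C = u * w" "D = v * z" "0 < u" "0 < v" "0 < w" "0 < z"
proof -
  define u where "u = gcd A C"
  have u: "0 < u" using assms by (simp add: u_def)
  obtain v w where vw: "A = u * v" "C = u * w" unfolding u_def by (meson dvdE gcd_dvd1 gcd_dvd2)
  have "gcd (u * v) (u * w) = u" using u_def vw by metis
  then have "u * gcd v w = u * 1" using gcd_mult_distrib_nat[of u v w] by simp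
  then have "coprime v w" using u by (simp only: mult_cancel1 coprime_iff_gcd_eq_1) simp
  have e: "v * B = w * D" using assms(1) u by (simp add: vw)
  then have "w dvd v * B" by simp
  then have "w dvd B" using \<open>coprime v w\<close> by (simp add: coprime_dvd_mult_right_iff coprime_commute)
  then obtain z where z: "B = w * z" by (elim dvdE)
  have pos: "0 < v" "0 < w" "0 < z" using assms vw z by auto
  have "D = v * z" using e pos by (simp add: z)
  then show thesis using that vw z u pos by blast
qed

text \<open>The equation is (a - q)(a + q) = (r - p)(r + p). All four numbers are odd, so the half
  sums and half differences are integers A, B, C, D with A B = C D, each at most X, and they split
  into four factors. If a < q both differences change sign, which is recorded by a negative
  z.\<close>

lemma equal_sums_of_squares_param:
  fixes a p q r X :: nat
  assumes eq: "a\<^sup>2 + p\<^sup>2 = q\<^sup>2 + r\<^sup>2" and odd: "odd p" "odd q" "odd r"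
    and ne: "p \<noteq> q" "p \<noteq> r" and le: "a \<le> X" "p \<le> X" "q \<le> X" "r \<le> X"
  obtains u v w z :: int where
    "int q = u * v - w * z" "int r = u * w + v * z" "int p = u * w - v * z"
    "0 < u" "0 < v" "0 < w" "z \<noteq> 0"
    "u * v \<le> int X" "u * w \<le> int X" "v * \<bar>z\<bar> \<le> int X" "w * \<bar>z\<bar> \<le> int X"
proof -
  have "odd a"
  proof -
    have "even (q\<^sup>2 + r\<^sup>2)" using odd by simp
    then show ?thesis using eq odd by (metis even_add even_power zero_less_numeral)
  qed
  have "a \<noteq> q" using eq ne by auto
  then consider "q < a" | "a < q" by linarith
  then show thesis
  proof cases
    case 1
    then have "q\<^sup>2 < a\<^sup>2" by (simp add: power_strict_mono)
    then have "p\<^sup>2 < r\<^sup>2" using eq by linarith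
    then have "p < r" using power_less_imp_less_base by blast
    obtain A where A: "a + q = 2 * A" using \<open>odd a\<close> odd(2) by (metis dvdE odd_even_add)
    obtain B where B: "a = q + 2 * B" using \<open>odd a\<close> odd(2) 1
      by (metis dvdE even_diff_nat le_add_diff_inverse less_imp_le odd_even_add)
    obtain C where C: "r + p = 2 * C" using odd by (metis dvdE odd_even_add)
    obtain D where D: "r = p + 2 * D" using odd \<open>p < r\<close>
      by (metis dvdE even_diff_nat le_add_diff_inverse less_imp_le odd_even_add)
    have AC: "A = q + B" "C = p + D" using A B C D by auto
    have "A * B = C * D" using eq unfolding AC B D by (simp add: power2_eq_square algebra_simps)
    moreover have pos: "0 < A" "0 < B" "0 < C" "0 < D" using A B C D 1 \<open>p < r\<close> by auto
    ultimately obtain u v w z where f: "A = u * v" "B = w * z" "C = u * w" "D = v * z"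
      "0 < u" "0 < v" "0 < w" "0 < z" by (rule four_factors)
    have i: "int q = int A - int B" "int r = int C + int D" "int p = int C - int D"
      "int A \<le> int X" "int B \<le> int X" "int C \<le> int X" "int D \<le> int X" using AC B D le by auto
    show thesis
      by (rule that[of "int u" "int v" "int w" "int z"]) (use f i in auto)
  next
    case 2
    then have "a\<^sup>2 < q\<^sup>2" by (simp add: power_strict_mono)
    then have "r\<^sup>2 < p\<^sup>2" using eq by linarith
    then have "r < p" using power_less_imp_less_base by blast
    obtain A where A: "q + a = 2 * A" using \<open>odd a\<close> odd(2) by (metis dvdE odd_even_add)
    obtain B where B: "q = a + 2 * B" using \<open>odd a\<close> odd(2) 2
      by (metis dvdE even_diff_nat le_add_diff_inverse less_imp_le odd_even_add)
    obtain C where C: "p + r = 2 * C" using odd by (metis dvdE odd_even_add)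
    obtain D where D: "p = r + 2 * D" using odd \<open>r < p\<close>
      by (metis dvdE even_diff_nat le_add_diff_inverse less_imp_le odd_even_add)
    have AC: "A = a + B" "C = r + D" using A B C D by auto
    have "A * B = C * D" using eq unfolding AC B D by (simp add: power2_eq_square algebra_simps)
    moreover have pos: "0 < A" "0 < B" "0 < C" "0 < D" using A B C D 2 \<open>r < p\<close> \<open>odd a\<close> odd by (auto intro: Nat.gr0I)
    ultimately obtain u v w z where f: "A = u * v" "B = w * z" "C = u * w" "D = v * z"
      "0 < u" "0 < v" "0 < w" "0 < z" by (rule four_factors)
    have i: "int q = int A + int B" "int r = int C - int D" "int p = int C + int D"
      "int A \<le> int X" "int B \<le> int X" "int C \<le> int X" "int D \<le> int X" using AC B D le by auto
    show thesis
      by (rule that[of "int u" "int v" "int w" "- int z"]) (use f i in auto)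
  qed
qed

definition form_quads :: "nat \<Rightarrow> (int \<times> int \<times> int \<times> nat) set" where
  "form_quads X = {(\<alpha>, \<beta>, \<gamma>, t). \<alpha> \<noteq> 0 \<and> \<beta> \<noteq> 0 \<and> \<gamma> \<noteq> 0 \<and> \<alpha>\<^sup>2 \<noteq> \<beta>\<^sup>2 \<and> 0 < t \<and>
     (max \<bar>\<alpha>\<bar> \<bar>\<beta>\<bar>)\<^sup>2 \<le> int X \<and> max \<bar>\<alpha>\<bar> \<bar>\<beta>\<bar> * \<bar>\<gamma>\<bar> \<le> int X \<and> max \<bar>\<alpha>\<bar> \<bar>\<beta>\<bar> * int t \<le> int X \<and>
     prime_triple \<alpha> \<beta> \<gamma> t}"

text \<open>All four products of one of v, w with one of u, |z| are at most X, so max v w times max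
  u |z| is too, and one of these maxima has square at most X. That pair supplies the coefficients.
  The condition \<alpha>^2 \<noteq> \<beta>^2 holds because equality would give p = q or p =
  -q.\<close>

lemma equal_sums_of_squares_form_quads:
  fixes a p q r X :: nat
  assumes eq: "a\<^sup>2 + p\<^sup>2 = q\<^sup>2 + r\<^sup>2" and odd: "odd p" "odd q" "odd r"
    and pr: "prime p" "prime q" "prime r"
    and ne: "p \<noteq> q" "p \<noteq> r" and le: "a \<le> X" "p \<le> X" "q \<le> X" "r \<le> X"
  shows "(q, r, p) \<in> (\<lambda>(\<alpha>, \<beta>, \<gamma>, t). (nat \<bar>form1 \<alpha> \<beta> \<gamma> (int t)\<bar>, nat \<bar>form2 \<alpha> \<beta> \<gamma> (int t)\<bar>,
            nat \<bar>form3 \<alpha> \<beta> \<gamma> (int t)\<bar>)) ` form_quads X"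
proof -
  obtain u v w z :: int where f: "int q = u * v - w * z" "int r = u * w + v * z" "int p = u * w - v * z"
    and pos: "0 < u" "0 < v" "0 < w" "z \<noteq> 0"
    and b: "u * v \<le> int X" "u * w \<le> int X" "v * \<bar>z\<bar> \<le> int X" "w * \<bar>z\<bar> \<le> int X"
    using equal_sums_of_squares_param[OF eq odd ne le] by metis
  have pq: "int p \<noteq> int q" "int p \<noteq> int r" "0 < int p" "0 < int q" using ne pr prime_gt_0_nat by auto
  define m where "m = max v w"
  define m' where "m' = max u \<bar>z\<bar>"
  have mm: "m * m' \<le> int X" using b unfolding m_def m'_def max_def by (auto simp: mult.commute)
  have m1: "m * u \<le> int X" "m * \<bar>z\<bar> \<le> int X" "m' * v \<le> int X" "m' * w \<le> int X"
    using b unfolding m_def m'_def max_def by (auto simp: mult.commute)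
  show ?thesis
  proof (cases "m\<^sup>2 \<le> int X")
    case True
    have F: "form1 v w z (int (nat u)) = int q" "form2 v w z (int (nat u)) = int r" "form3 v w z (int (nat u)) = int p"
      using f pos by (auto simp: form1_def form2_def form3_def algebra_simps)
    have "v\<^sup>2 \<noteq> w\<^sup>2"
    proof
      assume "v\<^sup>2 = w\<^sup>2"
      then have "v = w" using pos by (simp add: power2_eq_iff_nonneg)
      then show False using f pq by (simp add: algebra_simps)
    qed
    moreover have "prime_triple v w z (nat u)"
      unfolding prime_triple_def F using pr pq by simp
    ultimately have "(v, w, z, nat u) \<in> form_quads X"
      unfolding form_quads_def using pos True m1 by (simp add: m_def)
    then show ?thesis using F by (intro image_eqI[where x = "(v, w, z, nat u)"]) auto
  next
    case False
    have "0 < m" "0 < m'" using pos by (auto simp: m_def m'_def)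
    have "m' < m"
    proof (rule ccontr)
      assume "\<not> m' < m"
      then have "m * m \<le> m * m'" using \<open>0 < m\<close> by (intro mult_left_mono) auto
      then show False using False mm by (simp add: power2_eq_square)
    qed
    then have "m' * m' \<le> m * m'" using \<open>0 < m'\<close> by (intro mult_right_mono) auto
    then have m'_sq: "m'\<^sup>2 \<le> int X" using mm by (simp add: power2_eq_square)
    \<comment> \<open>Exchanging the pairs fixes q and r and turns p into -p.\<close>
    have F: "form1 u z w (int (nat v)) = int q" "form2 u z w (int (nat v)) = int r" "form3 u z w (int (nat v)) = - int p"
      using f pos by (auto simp: form1_def form2_def form3_def algebra_simps)
    have "u\<^sup>2 \<noteq> z\<^sup>2"
    proof
      assume "u\<^sup>2 = z\<^sup>2"
      then have "u = z \<or> u = - z" by (simp add: power2_eq_iff)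
      then show False using f pq by (auto simp: algebra_simps)
    qed
    moreover have "prime_triple u z w (nat v)"
      unfolding prime_triple_def F using pr pq by simp
    ultimately have "(u, z, w, nat v) \<in> form_quads X"
      unfolding form_quads_def using pos m'_sq m1 by (simp add: m'_def)
    then show ?thesis using F by (intro image_eqI[where x = "(u, z, w, nat v)"]) auto
  qed
qed

section \<open>Counting the quadruples and the triples of primes\<close>

lemma card_UN_le_mult:
  assumes "finite I" "\<And>i. i \<in> I \<Longrightarrow> real (card (A i)) \<le> b"
  shows "real (card (\<Union>i\<in>I. A i)) \<le> real (card I) * b"
proof -
  have "card (\<Union>i\<in>I. A i) \<le> (\<Sum>i\<in>I. card (A i))" by (rule card_UN_le[OF assms(1)])
  then have "real (card (\<Union>i\<in>I. A i)) \<le> real (\<Sum>i\<in>I. card (A i))" by (rule of_nat_mono)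
  also have "\<dots> = (\<Sum>i\<in>I. real (card (A i)))" by simp
  also have "\<dots> \<le> (\<Sum>i\<in>I. b)" using assms(2) by (rule sum_mono)
  finally show ?thesis by simp
qed

text \<open>Grouped by m = max |\<alpha>| |\<beta>|: at most 12 m coefficient pairs, 2 X/m values of
  \<gamma> and b X/m values of t, together 24 b X^2 / m.\<close>

lemma card_form_quads_le:
  fixes X :: nat and b :: real
  assumes X: "0 < X" and b: "0 \<le> b"
    and tr: "\<And>N \<alpha> \<beta> \<gamma>. 0 < N \<Longrightarrow> X \<le> 4 * N\<^sup>2 \<Longrightarrow> \<bar>\<alpha>\<bar> \<le> int X \<Longrightarrow> \<bar>\<beta>\<bar> \<le> int X \<Longrightarrow> \<bar>\<gamma>\<bar> \<le> int X \<Longrightarrow>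
      \<alpha> \<noteq> 0 \<Longrightarrow> \<beta> \<noteq> 0 \<Longrightarrow> \<gamma> \<noteq> 0 \<Longrightarrow> \<alpha>\<^sup>2 \<noteq> \<beta>\<^sup>2 \<Longrightarrow>
      real (card {t \<in> {1..N}. prime_triple \<alpha> \<beta> \<gamma> t}) \<le> b * real N"
  shows "finite (form_quads X)" "real (card (form_quads X)) \<le> 24 * b * (real X)\<^sup>2 * (1 + ln (real X))"
proof -
  define ok where "ok = (\<lambda>(\<alpha>::int) (\<beta>::int) (\<gamma>::int). \<alpha> \<noteq> 0 \<and> \<beta> \<noteq> 0 \<and> \<gamma> \<noteq> 0 \<and> \<alpha>\<^sup>2 \<noteq> \<beta>\<^sup>2)"
  define T where "T = (\<lambda>(m::nat) (x::int \<times> int) (\<gamma>::int). (\<lambda>t. (fst x, snd x, \<gamma>, t)) ` {t \<in> {1..X div m}. ok (fst x) (snd x) \<gamma> \<and> prime_triple (fst x) (snd x) \<gamma> t})"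
  define G where "G = (\<lambda>m. {- int (X div m)..int (X div m)} - {0})"
  \<comment> \<open>Contains the boundary of the square of half-side m; only linearly many pairs in
    m have maximum exactly m.\<close>
  define Pr where "Pr = (\<lambda>m. {- int m..int m} \<times> {- int m, int m} \<union> {- int m, int m} \<times> {- int m..int m})"
  define I where "I = {m. 0 < m \<and> m\<^sup>2 \<le> X}"
  have ImX: "m \<le> X" "0 < m" if "m \<in> I" for m
    using that power2_nat_le_imp_le[of m X] by (auto simp: I_def)
  have finI: "finite I" by (rule finite_subset[of _ "{..X}"]) (auto dest: ImX)
  have finG: "finite (G m)" for m by (simp add: G_def)
  have finP: "finite (Pr m)" for m by (simp add: Pr_def)
  have cG: "real (card (G m)) \<le> 2 * real (X div m)" for m
  proof -
    have "card (G m) = card {- int (X div m)..int (X div m)} - 1" unfolding G_def by (intro card_Diff_singleton) auto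
    then show ?thesis by simp
  qed
  have cP: "real (card (Pr m)) \<le> 12 * real m" if "0 < m" for m
  proof -
    have "card (Pr m) \<le> (2 * m + 1) * 2 + 2 * (2 * m + 1)"
      unfolding Pr_def using that
      by (intro order_trans[OF card_Un_le] add_mono) (auto simp: card_cartesian_product)
    also have "\<dots> \<le> 12 * m" using that by simp
    finally have "real (card (Pr m)) \<le> real (12 * m)" by (rule of_nat_mono)
    then show ?thesis by simp
  qed
  have sub: "form_quads X \<subseteq> (\<Union>m\<in>I. \<Union>x\<in>Pr m. \<Union>\<gamma>\<in>G m. T m x \<gamma>)"
  proof (rule subsetI)
    fix s assume "s \<in> form_quads X"
    then obtain \<alpha> \<beta> \<gamma> t where s: "s = (\<alpha>, \<beta>, \<gamma>, t)" and h: "\<alpha> \<noteq> 0" "\<beta> \<noteq> 0" "\<gamma> \<noteq> 0" "\<alpha>\<^sup>2 \<noteq> \<beta>\<^sup>2" "0 < t"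
      "(max \<bar>\<alpha>\<bar> \<bar>\<beta>\<bar>)\<^sup>2 \<le> int X" "max \<bar>\<alpha>\<bar> \<bar>\<beta>\<bar> * \<bar>\<gamma>\<bar> \<le> int X" "max \<bar>\<alpha>\<bar> \<bar>\<beta>\<bar> * int t \<le> int X"
      "prime_triple \<alpha> \<beta> \<gamma> t" by (auto simp: form_quads_def)
    define m where "m = nat (max \<bar>\<alpha>\<bar> \<bar>\<beta>\<bar>)"
    have m: "int m = max \<bar>\<alpha>\<bar> \<bar>\<beta>\<bar>" "0 < m" using h(1) by (simp_all add: m_def le_max_iff_disj less_max_iff_disj)
    have "int (m\<^sup>2) \<le> int X" using h(6) m(1) by simp
    then have mI: "m \<in> I" using m(2) unfolding I_def by (simp only: of_nat_le_iff mem_Collect_eq)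
    have bd: "k \<le> X div m" if "int m * int k \<le> int X" for k
    proof -
      have "k * m \<le> X" using that by (simp add: mult.commute flip: of_nat_mult)
      then show ?thesis using m(2) by (simp add: less_eq_div_iff_mult_less_eq)
    qed
    have "t \<le> X div m" by (rule bd) (use h(8) m(1) in simp)
    moreover have "nat \<bar>\<gamma>\<bar> \<le> X div m" by (rule bd) (use h(7) m(1) in simp)
    then have "\<bar>\<gamma>\<bar> \<le> int (X div m)" by (simp add: nat_le_iff)
    then have "\<gamma> \<in> G m" using h(3) by (simp add: G_def abs_le_iff)
    moreover have "(\<alpha>, \<beta>) \<in> Pr m"
      using m(1) unfolding Pr_def by (auto simp: max_def split: if_splits)
    ultimately show "s \<in> (\<Union>m\<in>I. \<Union>x\<in>Pr m. \<Union>\<gamma>\<in>G m. T m x \<gamma>)"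
      using mI h s unfolding T_def ok_def by (intro UN_I[of m] UN_I[of "(\<alpha>, \<beta>)"] UN_I[of \<gamma>]) auto
  qed
  have finT: "finite (T m x \<gamma>)" for m x \<gamma> by (simp add: T_def)
  have fin: "finite (\<Union>m\<in>I. \<Union>x\<in>Pr m. \<Union>\<gamma>\<in>G m. T m x \<gamma>)"
    using finI finP finG finT by (intro finite_UN_I) auto
  show "finite (form_quads X)" using sub fin by (rule finite_subset)
  have cT: "real (card (T m x \<gamma>)) \<le> b * real (X div m)" if m: "m \<in> I" and x: "x \<in> Pr m" and \<gamma>: "\<gamma> \<in> G m" for m x \<gamma>
  proof (cases "ok (fst x) (snd x) \<gamma>")
    case False
    then have "T m x \<gamma> = {}" by (simp add: T_def)
    then show ?thesis using b by simp
  next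
    case True
    let ?N = "X div m"
    have mm: "0 < m" "m * m \<le> X" using m by (auto simp: I_def power2_eq_square)
    \<comment> \<open>From m^2 \<le> X the range of t is at least as long as m, so X < ?N m + m
      yields X \<le> 4 ?N^2. This is where the smallness of the coefficient pair is used.\<close>
    then have mN: "m \<le> ?N" by (simp add: less_eq_div_iff_mult_less_eq)
    have "X < ?N * m + m" using mm dividend_less_div_times[of m X] by simp
    also have "\<dots> \<le> ?N * ?N + ?N * ?N" using mN mm by (intro add_mono mult_left_mono) (auto intro: order_trans[OF mN])
    finally have XN: "X \<le> 4 * ?N\<^sup>2" by (simp add: power2_eq_square)
    have "?N \<le> X" by simp
    have "card (T m x \<gamma>) = card {t \<in> {1..?N}. prime_triple (fst x) (snd x) \<gamma> t}"
      unfolding T_def using True by (subst card_image) (auto simp: inj_on_def)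
    moreover have "real (card {t \<in> {1..?N}. prime_triple (fst x) (snd x) \<gamma> t}) \<le> b * real ?N"
    proof (rule tr)
      show "\<bar>fst x\<bar> \<le> int X" "\<bar>snd x\<bar> \<le> int X" using x ImX(1)[OF m] by (auto simp: Pr_def)
      have "\<bar>\<gamma>\<bar> \<le> int ?N" using \<gamma> by (auto simp: G_def)
      then show "\<bar>\<gamma>\<bar> \<le> int X" using \<open>?N \<le> X\<close> by linarith
      show "0 < ?N" using mm mN by linarith
    qed (use XN True in \<open>auto simp: ok_def\<close>)
    ultimately show ?thesis by simp
  qed
  have "real (card (form_quads X)) \<le> real (card (\<Union>m\<in>I. \<Union>x\<in>Pr m. \<Union>\<gamma>\<in>G m. T m x \<gamma>))"
    using sub fin by (intro of_nat_mono card_mono)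
  also have "\<dots> \<le> real (\<Sum>m\<in>I. card (\<Union>x\<in>Pr m. \<Union>\<gamma>\<in>G m. T m x \<gamma>))"
    by (intro of_nat_mono card_UN_le finI)
  also have "\<dots> = (\<Sum>m\<in>I. real (card (\<Union>x\<in>Pr m. \<Union>\<gamma>\<in>G m. T m x \<gamma>)))" by simp
  also have "\<dots> \<le> (\<Sum>m\<in>I. 24 * b * (real X)\<^sup>2 * (1 / real m))"
  proof (rule sum_mono)
    fix m assume m: "m \<in> I"
    have N: "real (X div m) \<le> real X / real m" by (rule of_nat_div_le_of_nat)
    have "real (card (\<Union>\<gamma>\<in>G m. T m x \<gamma>)) \<le> 2 * real (X div m) * (b * real (X div m))" if x: "x \<in> Pr m" for x
    proof -
      have "real (card (\<Union>\<gamma>\<in>G m. T m x \<gamma>)) \<le> real (card (G m)) * (b * real (X div m))"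
        using cT[OF m x] finG by (intro card_UN_le_mult)
      also have "\<dots> \<le> 2 * real (X div m) * (b * real (X div m))" using cG b by (intro mult_right_mono) auto
      finally show ?thesis .
    qed
    then have "real (card (\<Union>x\<in>Pr m. \<Union>\<gamma>\<in>G m. T m x \<gamma>)) \<le> real (card (Pr m)) * (2 * real (X div m) * (b * real (X div m)))"
      using finP by (intro card_UN_le_mult)
    also have "\<dots> \<le> 12 * real m * (2 * (real X / real m) * (b * (real X / real m)))"
      using cP[OF ImX(2)[OF m]] N b by (intro mult_mono) auto
    also have "\<dots> = 24 * b * (real X)\<^sup>2 * (1 / real m)"
      using ImX(2)[OF m] by (simp add: power2_eq_square)
    finally show "real (card (\<Union>x\<in>Pr m. \<Union>\<gamma>\<in>G m. T m x \<gamma>)) \<le> 24 * b * (real X)\<^sup>2 * (1 / real m)" .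
  qed
  also have "\<dots> = 24 * b * (real X)\<^sup>2 * (\<Sum>m\<in>I. 1 / real m)" by (simp only: sum_distrib_left)
  also have "\<dots> \<le> 24 * b * (real X)\<^sup>2 * (1 + ln (real X))"
  proof (rule mult_left_mono)
    have "(\<Sum>m\<in>I. 1 / real m) \<le> (\<Sum>m\<in>{1..X}. 1 / real m)"
      using ImX by (intro sum_mono2) (auto simp: Suc_le_eq)
    also have "\<dots> \<le> 1 + ln (real X)" by (rule harmonic_le_ln[OF X])
    finally show "(\<Sum>m\<in>I. 1 / real m) \<le> 1 + ln (real X)" .
  qed (use b in auto)
  finally show "real (card (form_quads X)) \<le> 24 * b * (real X)\<^sup>2 * (1 + ln (real X))" .
qed

text \<open>The number a is only quantified, since q, r and p determine it.\<close>

definition square_triples :: "nat \<Rightarrow> (nat \<times> nat \<times> nat) set" where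
  "square_triples X = {(q, r, p). prime q \<and> prime r \<and> prime p \<and> q \<le> X \<and> r \<le> X \<and> p \<le> X \<and>
     (\<exists>a\<le>X. a\<^sup>2 + p\<^sup>2 = q\<^sup>2 + r\<^sup>2)}"

lemma card_square_triples_le:
  assumes "finite (form_quads X)"
  shows "card (square_triples X) \<le> card (form_quads X) + 5 * (card {p. prime p \<and> p \<le> X})\<^sup>2"
proof -
  let ?P = "{p::nat. prime p \<and> p \<le> X}"
  let ?F = "(\<lambda>(\<alpha>, \<beta>, \<gamma>, t). (nat \<bar>form1 \<alpha> \<beta> \<gamma> (int t)\<bar>, nat \<bar>form2 \<alpha> \<beta> \<gamma> (int t)\<bar>,
            nat \<bar>form3 \<alpha> \<beta> \<gamma> (int t)\<bar>)) ` form_quads X"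
  \<comment> \<open>Five degenerate families, p = q, p = r, q = 2, r = 2 and p = 2, each leaving two
    primes free. All remaining triples lie in the image of \<open>form_quads\<close>.\<close>
  define Dg where "Dg = (\<lambda>i::nat. (\<lambda>(x::nat, y::nat). if i = 0 then (x, y, x) else if i = 1 then (x, y, y)
       else if i = 2 then (2, x, y) else if i = 3 then (x, 2, y) else (x, y, 2)) ` (?P \<times> ?P))"
  have finP: "finite (?P \<times> ?P)" by simp
  have "square_triples X \<subseteq> ?F \<union> (\<Union>i\<in>{..<5}. Dg i)"
  proof (rule subsetI)
    fix s assume "s \<in> square_triples X"
    then obtain q r p a where s: "s = (q, r, p)" and h: "prime q" "prime r" "prime p" "q \<le> X" "r \<le> X" "p \<le> X"
      "a \<le> X" "a\<^sup>2 + p\<^sup>2 = q\<^sup>2 + r\<^sup>2" by (auto simp: square_triples_def)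
    have inP: "q \<in> ?P" "r \<in> ?P" "p \<in> ?P" using h by auto
    consider "p = q" | "p = r" | "q = 2" | "r = 2" | "p = 2" | "odd p" "odd q" "odd r" "p \<noteq> q" "p \<noteq> r"
      using h prime_odd_nat prime_ge_2_nat by (metis le_neq_implies_less)
    then show "s \<in> ?F \<union> (\<Union>i\<in>{..<5}. Dg i)"
    proof cases
      case 1
      then have "s \<in> Dg 0" using s inP by (auto simp: Dg_def)
      then show ?thesis by auto
    next
      case 2
      then have "s \<in> Dg 1" using s inP by (auto simp: Dg_def)
      then show ?thesis by auto
    next
      case 3
      then have "s \<in> Dg 2" using s inP by (auto simp: Dg_def)
      then show ?thesis by auto
    next
      case 4
      then have "s \<in> Dg 3" using s inP by (auto simp: Dg_def)
      then show ?thesis by auto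
    next
      case 5
      then have "s \<in> Dg 4" using s inP by (auto simp: Dg_def)
      then show ?thesis by auto
    next
      case 6
      then have "s \<in> ?F" unfolding s using h by (intro equal_sums_of_squares_form_quads[where a = a]) auto
      then show ?thesis by simp
    qed
  qed
  then have "card (square_triples X) \<le> card (?F \<union> (\<Union>i\<in>{..<5}. Dg i))"
    using assms finP by (intro card_mono) (auto simp: Dg_def)
  also have "\<dots> \<le> card ?F + card (\<Union>i\<in>{..<5}. Dg i)" by (rule card_Un_le)
  also have "\<dots> \<le> card (form_quads X) + 5 * (card ?P)\<^sup>2"
  proof (intro add_mono card_image_le assms)
    have "card (\<Union>i\<in>{..<5}. Dg i) \<le> (\<Sum>i\<in>{..<5}. card (Dg i))" by (rule card_UN_le) simp
    also have "\<dots> \<le> (\<Sum>i\<in>{..<5::nat}. (card ?P)\<^sup>2)"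
    proof (rule sum_mono)
      fix i
      have "card (Dg i) \<le> card (?P \<times> ?P)" unfolding Dg_def by (rule card_image_le[OF finP])
      then show "card (Dg i) \<le> (card ?P)\<^sup>2" by (simp add: card_cartesian_product power2_eq_square)
    qed
    finally show "card (\<Union>i\<in>{..<5}. Dg i) \<le> 5 * (card ?P)\<^sup>2" by simp
  qed
  finally show ?thesis .
qed

section \<open>The bounds\<close>

lemma square_triples_bound:
  obtains C where "0 < C"
    "eventually (\<lambda>X::nat. real (card (square_triples X)) \<le> C * ((real X)\<^sup>2 / (ln (real X))\<^sup>2 * (ln (ln (real X)))\<^sup>2)) sequentially"
proof -
  obtain C1 where C1: "0 < C1" and e1: "eventually (\<lambda>X::nat. \<forall>N \<alpha> \<beta> \<gamma>. 0 < N \<longrightarrow> X \<le> 4 * N\<^sup>2 \<longrightarrow>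
       \<bar>\<alpha>\<bar> \<le> int X \<longrightarrow> \<bar>\<beta>\<bar> \<le> int X \<longrightarrow> \<bar>\<gamma>\<bar> \<le> int X \<longrightarrow> \<alpha> \<noteq> 0 \<longrightarrow> \<beta> \<noteq> 0 \<longrightarrow> \<gamma> \<noteq> 0 \<longrightarrow> \<alpha>\<^sup>2 \<noteq> \<beta>\<^sup>2 \<longrightarrow>
       real (card {t \<in> {1..N}. prime_triple \<alpha> \<beta> \<gamma> t}) \<le> C1 * real N * ((ln (ln (real X)))\<^sup>2 / ln (real X) ^ 3)) sequentially"
    by (rule card_prime_triple_bound)
  obtain C2 where C2: "0 < C2" and e2: "eventually (\<lambda>n. real (card {p. prime p \<and> p \<le> n}) \<le> C2 * (real n / ln (real n))) sequentially"
    by (rule chebyshev_upper)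
  have e3: "eventually (\<lambda>X::nat. 1 \<le> ln (ln (real X))) sequentially" by real_asymp
  have e4: "eventually (\<lambda>X::nat. 1 \<le> ln (real X)) sequentially" by real_asymp
  \<comment> \<open>The factor 48 = 24 * 2 comes from 1 + l \<le> 2 l, where the logarithm of the
    harmonic sum cancels one of the three in b. The second summand accounts for the degenerate
    families, whose contribution X^2/l^2 is enlarged by (ln l)^2 \<ge> 1.\<close>
  define C where "C = 48 * C1 + 5 * C2\<^sup>2"
  have "eventually (\<lambda>X::nat. real (card (square_triples X)) \<le> C * ((real X)\<^sup>2 / (ln (real X))\<^sup>2 * (ln (ln (real X)))\<^sup>2)) sequentially"
    using e1 e2 e3 e4 eventually_gt_at_top[of 0]
  proof eventually_elim
    case (elim X)
    define l where "l = ln (real X)"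
    define b where "b = C1 * ((ln l)\<^sup>2 / l ^ 3)"
    have l: "1 \<le> l" "1 \<le> ln l" using elim by (auto simp: l_def)
    have b: "0 \<le> b" using C1 l by (simp add: b_def)
    have tr: "real (card {t \<in> {1..N}. prime_triple \<alpha> \<beta> \<gamma> t}) \<le> b * real N"
      if "0 < N" "X \<le> 4 * N\<^sup>2" "\<bar>\<alpha>\<bar> \<le> int X" "\<bar>\<beta>\<bar> \<le> int X" "\<bar>\<gamma>\<bar> \<le> int X" "\<alpha> \<noteq> 0" "\<beta> \<noteq> 0" "\<gamma> \<noteq> 0" "\<alpha>\<^sup>2 \<noteq> \<beta>\<^sup>2"
      for N \<alpha> \<beta> \<gamma>
    proof -
      have "real (card {t \<in> {1..N}. prime_triple \<alpha> \<beta> \<gamma> t}) \<le> C1 * real N * ((ln (ln (real X)))\<^sup>2 / ln (real X) ^ 3)"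
        using elim(1) that by blast
      then show ?thesis by (simp add: b_def l_def mult_ac)
    qed
    have fq: "finite (form_quads X)" "real (card (form_quads X)) \<le> 24 * b * (real X)\<^sup>2 * (1 + l)"
      using card_form_quads_le[OF elim(5) b tr] by (auto simp: l_def)
    have "real (card (square_triples X)) \<le> real (card (form_quads X) + 5 * (card {p. prime p \<and> p \<le> X})\<^sup>2)"
      by (intro of_nat_mono card_square_triples_le fq)
    also have "\<dots> = real (card (form_quads X)) + 5 * (real (card {p. prime p \<and> p \<le> X}))\<^sup>2" by simp
    also have "\<dots> \<le> 24 * b * (real X)\<^sup>2 * (2 * l) + 5 * (C2 * (real X / l))\<^sup>2"
    proof (intro add_mono mult_left_mono power_mono)
      have "24 * b * (real X)\<^sup>2 * (1 + l) \<le> 24 * b * (real X)\<^sup>2 * (2 * l)"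
        using l b by (intro mult_left_mono) auto
      then show "real (card (form_quads X)) \<le> 24 * b * (real X)\<^sup>2 * (2 * l)" using fq(2) by linarith
    qed (use elim in \<open>auto simp: l_def\<close>)
    also have "24 * b * (real X)\<^sup>2 * (2 * l) = 48 * C1 * ((real X)\<^sup>2 / l\<^sup>2 * (ln l)\<^sup>2)"
      using l by (simp add: b_def power2_eq_square power3_eq_cube)
    also have "5 * (C2 * (real X / l))\<^sup>2 = 5 * C2\<^sup>2 * ((real X)\<^sup>2 / l\<^sup>2 * 1)"
      by (simp add: power_mult_distrib power_divide)
    also have "\<dots> \<le> 5 * C2\<^sup>2 * ((real X)\<^sup>2 / l\<^sup>2 * (ln l)\<^sup>2)"
      using l by (intro mult_left_mono) auto
    finally show ?case by (simp only: C_def l_def distrib_right)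
  qed
  moreover have "0 < C" using C1 by (simp add: C_def add_pos_nonneg)
  ultimately show thesis using that by blast
qed

section \<open>From triples and pairs of primes to \<open>S12\<close>\<close>

lemma finite_r1_set: "finite {(a, p). 0 < (a::nat) \<and> prime p \<and> n = a\<^sup>2 + p\<^sup>2}"
proof (rule finite_subset)
  show "{(a, p). 0 < (a::nat) \<and> prime p \<and> n = a\<^sup>2 + p\<^sup>2} \<subseteq> {..n} \<times> {..n}"
    by (auto simp: power2_nat_le_imp_le trans_le_add1 trans_le_add2)
qed simp

lemma finite_r2_set: "finite {(p, q). prime (p::nat) \<and> prime q \<and> n = p\<^sup>2 + q\<^sup>2}"
proof (rule finite_subset)
  show "{(p, q). prime (p::nat) \<and> prime q \<and> n = p\<^sup>2 + q\<^sup>2} \<subseteq> {..n} \<times> {..n}"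
    by (auto simp: power2_nat_le_imp_le trans_le_add1 trans_le_add2)
qed simp

lemma finite_nat_le_real: "finite {n::nat. 0 < n \<and> real n \<le> x}"
  by (rule finite_subset[of _ "{..nat \<lfloor>x\<rfloor>}"]) (auto simp: le_nat_floor)

lemma S12_le_square_triples: "S12 x \<le> real (card (square_triples (nat \<lfloor>sqrt x\<rfloor>)))"
proof -
  define X where "X = nat \<lfloor>sqrt x\<rfloor>"
  let ?I = "{n::nat. 0 < n \<and> real n \<le> x}"
  let ?A = "\<lambda>n. {(a, p). 0 < (a::nat) \<and> prime p \<and> n = a\<^sup>2 + p\<^sup>2}"
  let ?B = "\<lambda>n. {(p, q). prime (p::nat) \<and> prime q \<and> n = p\<^sup>2 + q\<^sup>2}"
  let ?S = "SIGMA n:?I. ?A n \<times> ?B n"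
  have "S12 x = real (\<Sum>n\<in>?I. card (?A n \<times> ?B n))"
    by (simp add: S12_def r1_def r2_def card_cartesian_product)
  also have "(\<Sum>n\<in>?I. card (?A n \<times> ?B n)) = card ?S"
    by (subst card_SigmaI) (auto simp: finite_nat_le_real finite_r1_set finite_r2_set)
  also have "card ?S \<le> card (square_triples X)"
  proof (rule card_inj_on_le)
    let ?f = "\<lambda>(n::nat, (a::nat, p::nat), (q::nat, r::nat)). (q, r, p)"
    \<comment> \<open>The primes q and r determine n, and then p determines a, since a is
      nonnegative.\<close>
    show "inj_on ?f ?S"
    proof (rule inj_onI)
      fix s s' assume S: "s \<in> ?S" "s' \<in> ?S" and e: "?f s = ?f s'"
      obtain n a p q r where s: "s = (n, (a, p), (q, r))" "n = a\<^sup>2 + p\<^sup>2" "n = q\<^sup>2 + r\<^sup>2"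
        using S(1) by blast
      obtain n' a' p' q' r' where s': "s' = (n', (a', p'), (q', r'))" "n' = a'\<^sup>2 + p'\<^sup>2" "n' = q'\<^sup>2 + r'\<^sup>2"
        using S(2) by blast
      have qrp: "q = q'" "r = r'" "p = p'" using e s(1) s'(1) by auto
      then have "n = n'" using s(3) s'(3) by simp
      then have "a\<^sup>2 = a'\<^sup>2" using s(2) s'(2) qrp by simp
      then have "a = a'" by (simp add: power2_eq_iff_nonneg)
      then show "s = s'" using s(1) s'(1) qrp \<open>n = n'\<close> by simp
    qed
    have le: "k \<le> X" if "real n \<le> x" "k\<^sup>2 \<le> n" for k n
    proof -
      have "real (k\<^sup>2) \<le> real n" using that(2) by (rule of_nat_mono)
      then have "(real k)\<^sup>2 \<le> x" using that(1) by (simp only: of_nat_power)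
      then have "real k \<le> sqrt x" by (rule real_le_rsqrt)
      then show ?thesis unfolding X_def by (rule le_nat_floor)
    qed
    show "?f ` ?S \<subseteq> square_triples X"
    proof (rule image_subsetI)
      fix s assume "s \<in> ?S"
      then obtain n a p q r where s: "s = (n, (a, p), (q, r))" and h: "real n \<le> x" "prime p" "prime q" "prime r"
        "n = a\<^sup>2 + p\<^sup>2" "n = q\<^sup>2 + r\<^sup>2" by blast
      have "a \<le> X" "p \<le> X" "q \<le> X" "r \<le> X"
        using le[OF h(1), of a] le[OF h(1), of p] h(5) le[OF h(1), of q] le[OF h(1), of r] h(6) by auto
      moreover have "a\<^sup>2 + p\<^sup>2 = q\<^sup>2 + r\<^sup>2" using h by metis
      ultimately show "?f s \<in> square_triples X" using h(2-4) unfolding s square_triples_def by auto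
    qed
    have "square_triples X \<subseteq> {..X} \<times> {..X} \<times> {..X}" by (auto simp: square_triples_def)
    then show "finite (square_triples X)" by (rule finite_subset) simp
  qed
  finally show ?thesis by (simp add: X_def)
qed

lemma S12_ge_prime_pairs:
  assumes "8 * (real j)\<^sup>2 \<le> x"
  shows "(real (card {p. prime p \<and> p \<le> 2 * j}))\<^sup>2 \<le> S12 x"
proof -
  let ?I = "{n::nat. 0 < n \<and> real n \<le> x}"
  let ?P = "{p::nat. prime p \<and> p \<le> 2 * j}"
  let ?A = "\<lambda>n. {(a, p). 0 < (a::nat) \<and> prime p \<and> n = a\<^sup>2 + p\<^sup>2}"
  let ?B = "\<lambda>n. {(p, q). prime (p::nat) \<and> prime q \<and> n = p\<^sup>2 + q\<^sup>2}"
  have "card (?P \<times> ?P) \<le> card (\<Union>n\<in>?I. ?B n)"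
  proof (rule card_mono)
    show "finite (\<Union>n\<in>?I. ?B n)" using finite_nat_le_real finite_r2_set by (intro finite_UN_I) auto
    show "?P \<times> ?P \<subseteq> (\<Union>n\<in>?I. ?B n)"
    proof (rule subsetI)
      fix s assume "s \<in> ?P \<times> ?P"
      then obtain p q where s: "s = (p, q)" and h: "prime p" "prime q" "p \<le> 2 * j" "q \<le> 2 * j" by auto
      have "p\<^sup>2 + q\<^sup>2 \<le> (2 * j)\<^sup>2 + (2 * j)\<^sup>2" using h by (intro add_mono power_mono) auto
      then have "real (p\<^sup>2 + q\<^sup>2) \<le> real ((2 * j)\<^sup>2 + (2 * j)\<^sup>2)" by (rule of_nat_mono)
      then have "real (p\<^sup>2 + q\<^sup>2) \<le> x" using assms by (simp add: power_mult_distrib)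
      moreover have "0 < p\<^sup>2 + q\<^sup>2" using h(1) prime_gt_0_nat by simp
      ultimately have "p\<^sup>2 + q\<^sup>2 \<in> ?I" by (simp only: mem_Collect_eq)
      then show "s \<in> (\<Union>n\<in>?I. ?B n)" using h(1,2) s by (intro UN_I[of "p\<^sup>2 + q\<^sup>2"]) auto
    qed
  qed
  also have "\<dots> \<le> (\<Sum>n\<in>?I. card (?B n))" by (rule card_UN_le[OF finite_nat_le_real])
  also have "\<dots> \<le> (\<Sum>n\<in>?I. r1 n * r2 n)"
  proof (rule sum_mono)
    fix n
    show "card (?B n) \<le> r1 n * r2 n"
    proof (cases "?B n = {}")
      case False
      then obtain p q where pq: "prime p" "prime q" "n = p\<^sup>2 + q\<^sup>2" by auto
      then have "(p, q) \<in> ?A n" using prime_gt_0_nat by auto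
      then have "0 < r1 n" unfolding r1_def using finite_r1_set[of n] card_gt_0_iff by blast
      then have "1 * r2 n \<le> r1 n * r2 n" by (intro mult_right_mono) auto
      then show ?thesis by (simp add: r2_def)
    next
      case True
      then show ?thesis by (simp only: card.empty)
    qed
  qed
  finally have "real (card (?P \<times> ?P)) \<le> real (\<Sum>n\<in>?I. r1 n * r2 n)" by (rule of_nat_mono)
  then show ?thesis by (simp add: S12_def card_cartesian_product power2_eq_square)
qed

lemma S12_lower: "eventually (\<lambda>x. x / (ln x)\<^sup>2 \<le> (4 / (ln 2)\<^sup>2) * S12 x) at_top"
proof -
  have "eventually (\<lambda>x::real. sqrt x / 4 \<le> sqrt x / 3 - 1) at_top" by real_asymp
  then show ?thesis using eventually_gt_at_top[of 100]
  proof eventually_elim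
    case (elim x)
    \<comment> \<open>Primes up to 2 j give p^2 + q^2 \<le> 8 j^2 \<le> x. Comparison with sqrt(x/9)
      = sqrt x / 3 shows j \<ge> sqrt x / 4 despite the rounding.\<close>
    define j where "j = nat \<lfloor>sqrt (x / 8)\<rfloor>"
    have s0: "0 \<le> sqrt (x / 8)" using elim by simp
    have j_le: "real j \<le> sqrt (x / 8)" unfolding j_def using s0 by simp
    have j_ge: "sqrt x / 4 \<le> real j"
    proof -
      have "sqrt (x / 9) \<le> sqrt (x / 8)" using elim by (intro real_sqrt_le_mono divide_left_mono) auto
      then have "sqrt x / 3 \<le> sqrt (x / 8)" using real_sqrt_abs[of 3] by (simp add: real_sqrt_divide)
      moreover have "real j = real_of_int \<lfloor>sqrt (x / 8)\<rfloor>" unfolding j_def using s0 by simp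
      ultimately show ?thesis using elim(1) real_of_int_floor_add_one_ge[of "sqrt (x / 8)"] by linarith
    qed
    have "sqrt 100 \<le> sqrt x" using elim by (intro real_sqrt_le_mono) auto
    then have s10: "10 \<le> sqrt x" using real_sqrt_abs[of 10] by simp
    then have j1: "1 < real j" using j_ge by linarith
    have "(real j)\<^sup>2 \<le> (sqrt (x / 8))\<^sup>2" using j_le by (intro power_mono) auto
    then have j8: "8 * (real j)\<^sup>2 \<le> x" using elim by simp
    then have "(2 * real j)\<^sup>2 \<le> x" using elim by (simp add: power_mult_distrib)
    then have "2 * real j \<le> sqrt x" by (rule real_le_rsqrt)
    then have "ln (2 * real j) \<le> ln (sqrt x)" using j1 by (intro ln_mono) auto
    then have lnj: "ln (2 * real j) \<le> ln x / 2" using elim by (simp add: ln_sqrt)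
    have lnx: "0 < ln x" using elim by simp
    have "sqrt x * ln 2 / (2 * ln x) = sqrt x / 4 * ln 2 / (ln x / 2)" by simp
    also have "\<dots> \<le> real j * ln 2 / ln (2 * real j)"
      using j_ge lnj j1 lnx by (intro frac_le mult_right_mono) auto
    also have "\<dots> \<le> real (card {p. prime p \<and> p \<le> 2 * j})"
      using j1 by (intro chebyshev_lower) auto
    finally have "(sqrt x * ln 2 / (2 * ln x))\<^sup>2 \<le> (real (card {p. prime p \<and> p \<le> 2 * j}))\<^sup>2"
      using lnx elim by (intro power_mono) auto
    also have "\<dots> \<le> S12 x" by (rule S12_ge_prime_pairs[OF j8])
    finally have "x * (ln 2)\<^sup>2 / (4 * (ln x)\<^sup>2) \<le> S12 x"
      using elim by (simp add: power_mult_distrib power_divide)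
    then have "4 / (ln 2)\<^sup>2 * (x * (ln 2)\<^sup>2 / (4 * (ln x)\<^sup>2)) \<le> 4 / (ln 2)\<^sup>2 * S12 x"
      by (intro mult_left_mono) auto
    then show ?case by simp
  qed
qed

lemma S12_upper:
  obtains C where "eventually (\<lambda>x. S12 x \<le> C * (x / (ln x)\<^sup>2 * (ln (ln x))\<^sup>2)) at_top"
proof -
  obtain C where C: "0 < C" and ev: "eventually (\<lambda>X::nat. real (card (square_triples X))
      \<le> C * ((real X)\<^sup>2 / (ln (real X))\<^sup>2 * (ln (ln (real X)))\<^sup>2)) sequentially"
    by (rule square_triples_bound)
  have "filterlim (\<lambda>x::real. nat \<lfloor>sqrt x\<rfloor>) sequentially at_top"
    by (intro filterlim_compose[OF filterlim_nat_sequentially] filterlim_compose[OF filterlim_floor_sequentially] sqrt_at_top)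
  from filterlim_iff[THEN iffD1, OF this, rule_format, OF ev]
  have e1: "eventually (\<lambda>x. real (card (square_triples (nat \<lfloor>sqrt x\<rfloor>)))
      \<le> C * ((real (nat \<lfloor>sqrt x\<rfloor>))\<^sup>2 / (ln (real (nat \<lfloor>sqrt x\<rfloor>)))\<^sup>2 * (ln (ln (real (nat \<lfloor>sqrt x\<rfloor>))))\<^sup>2)) at_top" .
  \<comment> \<open>The lower bound x^(1/4) for the rounded square root gives ln X \<ge> ln x / 4,
    which accounts for the factor 16 in the final constant.\<close>
  have e2: "eventually (\<lambda>x::real. x powr (1 / 4) \<le> sqrt x - 1) at_top" by real_asymp
  have e3: "eventually (\<lambda>x::real. 4 < ln x) at_top" by real_asymp
  have "eventually (\<lambda>x. S12 x \<le> (16 * C) * (x / (ln x)\<^sup>2 * (ln (ln x))\<^sup>2)) at_top"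
    using e1 e2 e3 eventually_gt_at_top[of 1]
  proof eventually_elim
    case (elim x)
    define X where "X = real (nat \<lfloor>sqrt x\<rfloor>)"
    have s0: "0 \<le> sqrt x" using elim by simp
    have X1: "X \<le> sqrt x" unfolding X_def using s0 by simp
    have "X = real_of_int \<lfloor>sqrt x\<rfloor>" using s0 by (simp add: X_def)
    then have X2: "x powr (1 / 4) \<le> X" using elim(2) real_of_int_floor_add_one_ge[of "sqrt x"] by linarith
    have Xx: "X \<le> x" using X1 sqrt_le_D real_sqrt_le_iff elim(4)
      by (smt (verit) real_less_lsqrt power2_eq_square mult_le_cancel_left1)
    have p: "1 < x powr (1 / 4)" using elim(4) by simp
    have "ln (x powr (1 / 4)) \<le> ln X" using X2 p by (intro ln_mono) auto
    then have lX: "ln x / 4 \<le> ln X" using elim(4) by (simp add: ln_powr)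
    have lX2: "ln X \<le> ln x" using Xx X2 p by (intro ln_mono) auto
    have lX1: "1 < ln X" using lX elim(3) by linarith
    have "S12 x \<le> C * (X\<^sup>2 / (ln X)\<^sup>2 * (ln (ln X))\<^sup>2)"
      using S12_le_square_triples[of x] elim(1) by (simp add: X_def)
    also have "\<dots> \<le> C * (x / (ln x / 4)\<^sup>2 * (ln (ln x))\<^sup>2)"
    proof (intro mult_left_mono mult_mono frac_le power_mono)
      have "X\<^sup>2 \<le> (sqrt x)\<^sup>2" using X1 X2 p by (intro power_mono) auto
      then show "X\<^sup>2 \<le> x" using elim(4) by simp
      show "ln (ln X) \<le> ln (ln x)" by (rule ln_mono[OF lX2]) (use lX1 in auto)
    qed (use lX lX1 elim C in auto)
    also have "\<dots> = (16 * C) * (x / (ln x)\<^sup>2 * (ln (ln x))\<^sup>2)" by (simp add: power_divide)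
    finally show ?case .
  qed
  then show thesis by (rule that)
qed

lemma S12_nonneg: "0 \<le> S12 x"
  unfolding S12_def by (intro sum_nonneg) auto

theorem theorem1p4:
  shows "(\<lambda>x::real. 2 * pi * x / (ln x)\<^sup>2) \<in> O[at_top](S12) \<and>
         S12 \<in> O[at_top](\<lambda>x::real. x / (ln x)\<^sup>2 * (ln (ln x))\<^sup>2)"
proof
  show "(\<lambda>x::real. 2 * pi * x / (ln x)\<^sup>2) \<in> O[at_top](S12)"
  proof (rule bigoI[where c = "2 * pi * (4 / (ln 2)\<^sup>2)"])
    show "eventually (\<lambda>x. norm (2 * pi * x / (ln x)\<^sup>2) \<le> 2 * pi * (4 / (ln 2)\<^sup>2) * norm (S12 x)) at_top"
      using S12_lower eventually_gt_at_top[of 0]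
    proof eventually_elim
      case (elim x)
      have "norm (2 * pi * x / (ln x)\<^sup>2) = 2 * pi * (x / (ln x)\<^sup>2)" using elim(2) by simp
      also have "\<dots> \<le> 2 * pi * ((4 / (ln 2)\<^sup>2) * S12 x)" using elim(1) by (intro mult_left_mono) auto
      finally show ?case using S12_nonneg[of x] by simp
    qed
  qed
  obtain C where "eventually (\<lambda>x. S12 x \<le> C * (x / (ln x)\<^sup>2 * (ln (ln x))\<^sup>2)) at_top"
    by (rule S12_upper)
  then have "eventually (\<lambda>x. norm (S12 x) \<le> C * norm (x / (ln x)\<^sup>2 * (ln (ln x))\<^sup>2)) at_top"
    using eventually_gt_at_top[of 0]
  proof eventually_elim
    case (elim x)
    then show ?case using S12_nonneg[of x] by simp
  qed
  then show "S12 \<in> O[at_top](\<lambda>x::real. x / (ln x)\<^sup>2 * (ln (ln x))\<^sup>2)" by (rule bigoI)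
qed

end
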